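(* Assume the convex-nonconcave setting: for every $y\in\mathcal Y$ the function $f(\cdot,y)$ is convex on $\mathcal X$ (no concavity of $f(x,\cdot)$ is assumed), and $f$ satisfies the Lipschitz gradient assumption with constants $L_{11},L_{12},L_{21},L_{22}>0$. Let $\bar\zeta,\bar\nu>0$ be constants with $\bar\zeta\le\frac1{10L_{11}}$, let $$\tau>\max\Big\{\frac{19^2(L_{22}+2\bar\nu-\bar\zeta L_{21}^2)}{20^2\cdot16\,\bar\zeta L_{21}^2},\,2\Big\},\qquad q_k=\frac{19}{20\bar\zeta k^{1/4}}\ (k\ge1),$$ $$\bar\gamma_k=\bar\zeta L_{21}^2+\frac{16\tau L_{21}^2}{\bar\zeta q_{k+1}^2}-2\bar\nu,\qquad \gamma_k=\bar\nu+\bar\gamma_k,\qquad p_k=\frac{8(\tau-2)L_{21}^2}{\bar\zeta q_{k+1}^2},$$ and let $\{(x_k,y_k)\}_{k\ge1}$ be generated from $(x_1,y_1)\in\mathcal X\times\mathcal Y$ by $$x_{k+1}=\mathcal P_{\mathcal X}\big(x_k-\bar\zeta\nabla_xf(x_k,y_k)-\bar\zeta q_kx_k\big),\qquad y_{k+1}=\mathcal P_{\mathcal Y}\big(y_k+\tfrac1{\gamma_k}\nabla_yf(x_{k+1},y_k)\big),\quad k\ge1.$$ Then for any given $\varepsilon>0$, $$T(\varepsilon)\le\max\left(\Big(\frac{2\cdot80^2\bar\zeta(\tau-2)L_{21}^2\hat d_3\hat d_4}{19^2\varepsilon^2}+2\Big)^2,\ \frac{19^4\hat\sigma_x^4}{10^4\bar\zeta^4\varepsilon^4}\right),$$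 where $\hat\sigma_x=\max\{\|x\|:x\in\mathcal X\}$, $\hat d_3=\hat{\mathcal F}_0-\hat{\mathcal F}_2+\frac{8\cdot2^{1/4}}{\bar\zeta}\hat\sigma_x^2+\frac{19}{40\bar\zeta}\hat\sigma_x^2$, $\hat d_4=\max\big\{\hat D_1,\frac{10+20\bar\zeta^2L_{12}^2}{9\bar\zeta p_2}\big\}$, $\hat D_1=\frac{16\tau^2}{(\tau-2)^2}+\frac{19^4(\bar\zeta L_{21}^2-\bar\nu)^2}{16\cdot20^4(\tau-2)^2L_{21}^4\bar\zeta^2}$, $\hat{\mathcal F}_0=\bar f+\big(2^{13/4}+15+\frac{19}{40}\big)\frac{\hat\sigma_x^2}{\bar\zeta}$ with $\bar f=\max_{(x,y)\in\mathcal X\times\mathcal Y}f(x,y)$, and $$\hat{\mathcal F}_2=f(x_2,y_2)-\frac{8}{\bar\zeta^2q_2}\|x_2-x_1\|^2-\frac8{\bar\zeta}\Big(1-\frac{q_1}{q_2}\Big)\|x_2\|^2+\frac{15}{2\bar\zeta}\|x_2-x_1\|^2+\frac{q_1}{2}\|x_2\|^2-\Big(\frac{\bar\zeta L_{21}^2}{2}+\frac{16L_{21}^2}{\bar\zeta q_2^2}\Big)\|y_2-y_1\|^2 .$$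
   Context: $\mathcal X\subseteq\mathbb R^n$ and $\mathcal Y\subseteq\mathbb R^m$ are nonempty closed bounded convex sets, $f:\mathcal X\times\mathcal Y\to\mathbb R$ is a smooth function, and the problem is $\min_{x\in\mathcal X}\max_{y\in\mathcal Y}f(x,y)$. $\|\cdot\|$ is the Euclidean norm; $\mathcal P_{\mathcal X},\mathcal P_{\mathcal Y}$ are Euclidean projections. Lipschitz gradient assumption: for all $x,\bar x\in\mathcal X$, $y,\bar y\in\mathcal Y$: $\|\nabla_xf(x,y)-\nabla_xf(\bar x,y)\|\le L_{11}\|x-\bar x\|$, $\|\nabla_xf(x,y)-\nabla_xf(x,\bar y)\|\le L_{21}\|y-\bar y\|$, $\|\nabla_yf(x,y)-\nabla_yf(x,\bar y)\|\le L_{22}\|y-\bar y\|$, $\|\nabla_yf(x,y)-\nabla_yf(\bar x,y)\|\le L_{12}\|x-\bar x\|$. Stationarity gap: $\nabla G(x_k,y_k)$ is the vector with the two blocks $\frac1{\bar\zeta}\big(x_k-\mathcal P_{\mathcal X}(x_k-\bar\zeta\nabla_xf(x_k,y_k))\big)$ and $\gamma_k\big(y_k-\mathcal P_{\mathcal Y}(y_k+\frac1{\gamma_k}\nabla_yf(x_k,y_k))\big)$. $T(\varepsilon)=\min\{k\ge1:\|\nabla G(x_k,y_k)\|\le\varepsilon\}$. *)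

theory Defs
  imports "HOL-Analysis.Analysis"
begin

text \<open>
  The objective has type \<open>'a \<Rightarrow> 'b \<Rightarrow> real\<close> over two Euclidean spaces; only its values on
  \<open>X \<times> Y\<close> are relevant. Projections are the library's \<^const>\<open>closest_point\<close>. The norm of a pair
  is the Euclidean norm of the concatenated vector. Sequences are indexed by \<^typ>\<open>nat\<close>, but only
  indices \<open>k \<ge> 1\<close> are meaningful.
\<close>

text \<open>
  \<open>gx x y\<close> and \<open>gy x y\<close> are the two blocks of the gradient of \<open>f\<close> at \<open>(x, y)\<close>. The
  derivative is taken within \<open>X \<times> Y\<close>, so \<open>f\<close> need not be given outside this set; if \<open>f\<close> is
  differentiable on an open neighbourhood of \<open>X \<times> Y\<close>, its ordinary partial gradients qualify.
  Where \<open>X \<times> Y\<close> has empty interior the gradient is not determined by \<open>f\<close> on \<open>X \<times> Y\<close>, and any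
  choice is allowed. Together with the Lipschitz bounds below (which make \<open>gx\<close> and \<open>gy\<close> jointly
  continuous) this says that \<open>f\<close> is continuously differentiable on \<open>X \<times> Y\<close>.
\<close>
definition has_gradient_blocks ::
  "('a::euclidean_space \<Rightarrow> 'b::euclidean_space \<Rightarrow> real) \<Rightarrow> ('a \<Rightarrow> 'b \<Rightarrow> 'a) \<Rightarrow> ('a \<Rightarrow> 'b \<Rightarrow> 'b) \<Rightarrow>
    'a set \<Rightarrow> 'b set \<Rightarrow> bool" where
  "has_gradient_blocks f gx gy X Y \<longleftrightarrow>
    (\<forall>x\<in>X. \<forall>y\<in>Y.
      ((\<lambda>(u, v). f u v) has_derivative (\<lambda>(h, k). gx x y \<bullet> h + gy x y \<bullet> k))
        (at (x, y) within X \<times> Y))"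

definition lipschitz_gradient ::
  "('a::euclidean_space \<Rightarrow> 'b::euclidean_space \<Rightarrow> 'a) \<Rightarrow> ('a \<Rightarrow> 'b \<Rightarrow> 'b) \<Rightarrow> 'a set \<Rightarrow> 'b set \<Rightarrow>
    real \<Rightarrow> real \<Rightarrow> real \<Rightarrow> real \<Rightarrow> bool" where
  "lipschitz_gradient gx gy X Y L11 L12 L21 L22 \<longleftrightarrow>
    (\<forall>x\<in>X. \<forall>x'\<in>X. \<forall>y\<in>Y. \<forall>y'\<in>Y.
      norm (gx x y - gx x' y) \<le> L11 * norm (x - x') \<and>
      norm (gx x y - gx x y') \<le> L21 * norm (y - y') \<and>
      norm (gy x y - gy x y') \<le> L22 * norm (y - y') \<and>
      norm (gy x y - gy x' y) \<le> L12 * norm (x - x'))"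

definition q_par :: "real \<Rightarrow> nat \<Rightarrow> real" where
  "q_par \<zeta> k = 19 / (20 * \<zeta> * real k powr (1/4))"

definition gammabar_par :: "real \<Rightarrow> real \<Rightarrow> real \<Rightarrow> real \<Rightarrow> nat \<Rightarrow> real" where
  "gammabar_par \<zeta> \<nu> \<tau> L21 k =
    \<zeta> * L21\<^sup>2 + 16 * \<tau> * L21\<^sup>2 / (\<zeta> * (q_par \<zeta> (k + 1))\<^sup>2) - 2 * \<nu>"

definition gamma_par :: "real \<Rightarrow> real \<Rightarrow> real \<Rightarrow> real \<Rightarrow> nat \<Rightarrow> real" where
  "gamma_par \<zeta> \<nu> \<tau> L21 k = \<nu> + gammabar_par \<zeta> \<nu> \<tau> L21 k"

definition p_par :: "real \<Rightarrow> real \<Rightarrow> real \<Rightarrow> nat \<Rightarrow> real" where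
  "p_par \<zeta> \<tau> L21 k = 8 * (\<tau> - 2) * L21\<^sup>2 / (\<zeta> * (q_par \<zeta> (k + 1))\<^sup>2)"

definition agp_iterates ::
  "'a::euclidean_space set \<Rightarrow> 'b::euclidean_space set \<Rightarrow> ('a \<Rightarrow> 'b \<Rightarrow> 'a) \<Rightarrow> ('a \<Rightarrow> 'b \<Rightarrow> 'b) \<Rightarrow>
    real \<Rightarrow> (nat \<Rightarrow> real) \<Rightarrow> (nat \<Rightarrow> real) \<Rightarrow> (nat \<Rightarrow> 'a) \<Rightarrow> (nat \<Rightarrow> 'b) \<Rightarrow> bool" where
  "agp_iterates X Y gx gy \<zeta> q \<gamma> x y \<longleftrightarrow>
    x 1 \<in> X \<and> y 1 \<in> Y \<and>
    (\<forall>k\<ge>1.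
      x (k + 1) = closest_point X (x k - \<zeta> *\<^sub>R gx (x k) (y k) - (\<zeta> * q k) *\<^sub>R x k) \<and>
      y (k + 1) = closest_point Y (y k + (1 / \<gamma> k) *\<^sub>R gy (x (k + 1)) (y k)))"

definition stationarity_gap ::
  "'a::euclidean_space set \<Rightarrow> 'b::euclidean_space set \<Rightarrow> ('a \<Rightarrow> 'b \<Rightarrow> 'a) \<Rightarrow> ('a \<Rightarrow> 'b \<Rightarrow> 'b) \<Rightarrow>
    real \<Rightarrow> (nat \<Rightarrow> real) \<Rightarrow> (nat \<Rightarrow> 'a) \<Rightarrow> (nat \<Rightarrow> 'b) \<Rightarrow> nat \<Rightarrow> 'a \<times> 'b" where
  "stationarity_gap X Y gx gy \<zeta> \<gamma> x y k =
    ((1 / \<zeta>) *\<^sub>R (x k - closest_point X (x k - \<zeta> *\<^sub>R gx (x k) (y k))),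
     \<gamma> k *\<^sub>R (y k - closest_point Y (y k + (1 / \<gamma> k) *\<^sub>R gy (x k) (y k))))"

text \<open>
  First index \<open>k \<ge> 1\<close> whose gap \<open>G k\<close> has norm at most \<open>\<epsilon>\<close>. It is \<open>\<infinity>\<close> if there is none, so
  a finite upper bound includes the existence of such an index.
\<close>
definition first_hit :: "(nat \<Rightarrow> 'c::real_normed_vector) \<Rightarrow> real \<Rightarrow> enat" where
  "first_hit G \<epsilon> = (INF k\<in>{k. k \<ge> 1 \<and> norm (G k) \<le> \<epsilon>}. enat k)"

text \<open>
  The next two suprema are maxima whenever the sets are nonempty and compact and \<open>f\<close> is
  continuous on \<open>X \<times> Y\<close>.
\<close>
definition sigma_x :: "'a::euclidean_space set \<Rightarrow> real" where
  "sigma_x X = (SUP x\<in>X. norm x)"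

definition f_max ::
  "('a::euclidean_space \<Rightarrow> 'b::euclidean_space \<Rightarrow> real) \<Rightarrow> 'a set \<Rightarrow> 'b set \<Rightarrow> real" where
  "f_max f X Y = (SUP (x, y)\<in>X \<times> Y. f x y)"

definition F0_const ::
  "('a::euclidean_space \<Rightarrow> 'b::euclidean_space \<Rightarrow> real) \<Rightarrow> 'a set \<Rightarrow> 'b set \<Rightarrow> real \<Rightarrow> real" where
  "F0_const f X Y \<zeta> = f_max f X Y + (2 powr (13/4) + 15 + 19/40) * ((sigma_x X)\<^sup>2 / \<zeta>)"

definition F2_const ::
  "('a::euclidean_space \<Rightarrow> 'b::euclidean_space \<Rightarrow> real) \<Rightarrow> real \<Rightarrow> real \<Rightarrow>
    (nat \<Rightarrow> 'a) \<Rightarrow> (nat \<Rightarrow> 'b) \<Rightarrow> real" where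
  "F2_const f \<zeta> L21 x y =
    f (x 2) (y 2)
    - 8 / (\<zeta>\<^sup>2 * q_par \<zeta> 2) * (norm (x 2 - x 1))\<^sup>2
    - 8 / \<zeta> * (1 - q_par \<zeta> 1 / q_par \<zeta> 2) * (norm (x 2))\<^sup>2
    + 15 / (2 * \<zeta>) * (norm (x 2 - x 1))\<^sup>2
    + q_par \<zeta> 1 / 2 * (norm (x 2))\<^sup>2
    - (\<zeta> * L21\<^sup>2 / 2 + 16 * L21\<^sup>2 / (\<zeta> * (q_par \<zeta> 2)\<^sup>2)) * (norm (y 2 - y 1))\<^sup>2"

definition d3_const ::
  "('a::euclidean_space \<Rightarrow> 'b::euclidean_space \<Rightarrow> real) \<Rightarrow> 'a set \<Rightarrow> 'b set \<Rightarrow> real \<Rightarrow> real \<Rightarrow>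
    (nat \<Rightarrow> 'a) \<Rightarrow> (nat \<Rightarrow> 'b) \<Rightarrow> real" where
  "d3_const f X Y \<zeta> L21 x y =
    F0_const f X Y \<zeta> - F2_const f \<zeta> L21 x y
    + 8 * 2 powr (1/4) / \<zeta> * (sigma_x X)\<^sup>2 + 19 / (40 * \<zeta>) * (sigma_x X)\<^sup>2"

definition D1_const :: "real \<Rightarrow> real \<Rightarrow> real \<Rightarrow> real \<Rightarrow> real" where
  "D1_const \<zeta> \<nu> \<tau> L21 =
    16 * \<tau>\<^sup>2 / (\<tau> - 2)\<^sup>2
    + 19 ^ 4 * (\<zeta> * L21\<^sup>2 - \<nu>)\<^sup>2 / (16 * 20 ^ 4 * (\<tau> - 2)\<^sup>2 * L21 ^ 4 * \<zeta>\<^sup>2)"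

definition d4_const :: "real \<Rightarrow> real \<Rightarrow> real \<Rightarrow> real \<Rightarrow> real \<Rightarrow> real" where
  "d4_const \<zeta> \<nu> \<tau> L12 L21 =
    max (D1_const \<zeta> \<nu> \<tau> L21)
        ((10 + 20 * \<zeta>\<^sup>2 * L12\<^sup>2) / (9 * \<zeta> * p_par \<zeta> \<tau> L21 2))"

end

theory Submission
  imports Defs
begin

text \<open>
  Convexity of \<open>f(\<cdot>, y)\<close>, together with the optimality conditions of two consecutive projections,
  gives an ascent inequality for a potential built from \<open>f(x\<^sub>k, y\<^sub>k)\<close>, the squared steps, and the
  regularization \<open>q\<^sub>k\<close>. Summed up, the squared steps, weighted by \<open>p\<^sub>k\<close> for \<open>y\<close> and by \<open>9/(10\<zeta>)\<close> for
  \<open>x\<close>, total at most \<open>d\<^sub>3\<close>. The squared gap of the regularized problem, divided by \<open>p\<^sub>k\<close>, is at most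
  \<open>d\<^sub>4\<close> times the weighted squared step, and \<open>1/p\<^sub>k\<close> decays only like \<open>1/sqrt k\<close>, so that a small
  gap must occur early. The true gap exceeds the regularized one by at most \<open>q\<^sub>k \<sigma>\<close>, which is at most
  \<open>\<epsilon>/2\<close> from \<open>k = (19\<sigma>/(10\<zeta>\<epsilon>))\<^sup>4\<close> on. A single index must be good for both parts; it exists because
  the constant \<open>d\<^sub>3 d\<^sub>4\<close> is large compared to \<open>\<sigma>\<^sup>2\<close>, so that the first bound dominates the second.
\<close>

section \<open>Convex functions with Lipschitz gradient\<close>

text \<open>Chain rule within the image of the segment, so that \<open>S\<close> may have empty
  interior; the bounds below become calculus on the unit interval.\<close>

lemma gradient_along_segment:
  fixes \<phi> :: "'a::real_inner \<Rightarrow> real"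
  assumes "convex S" and grad: "\<And>u. u \<in> S \<Longrightarrow> (\<phi> has_derivative (\<lambda>h. G u \<bullet> h)) (at u within S)"
    and "u \<in> S" "z \<in> S" "t \<in> {0..1}"
  shows "((\<lambda>t. \<phi> (u + t *\<^sub>R (z - u))) has_real_derivative G (u + t *\<^sub>R (z - u)) \<bullet> (z - u))
    (at t within {0..1})"
proof -
  have seg: "u + s *\<^sub>R (z - u) \<in> S" if "s \<in> {0..1}" for s
    using convexD_alt[OF assms(1,3,4), of s] that by (simp add: algebra_simps)
  have "((\<lambda>s. u + s *\<^sub>R (z - u)) has_derivative (\<lambda>s. s *\<^sub>R (z - u))) (at t within {0..1})"
    by (auto intro!: derivative_eq_intros)
  moreover have "(\<phi> has_derivative (\<lambda>h. G (u + t *\<^sub>R (z - u)) \<bullet> h))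
      (at (u + t *\<^sub>R (z - u)) within (\<lambda>s. u + s *\<^sub>R (z - u)) ` {0..1})"
    using assms(5) by (intro has_derivative_subset[OF grad] image_subsetI seg)
  ultimately have "((\<lambda>t. \<phi> (u + t *\<^sub>R (z - u))) has_derivative
      (\<lambda>s. G (u + t *\<^sub>R (z - u)) \<bullet> (s *\<^sub>R (z - u)))) (at t within {0..1})"
    by (rule has_derivative_in_compose)
  then show ?thesis
    unfolding has_field_derivative_def by (rule has_derivative_eq_rhs) (simp add: fun_eq_iff)
qed

text \<open>The descent lemma relative to \<open>S\<close>. Subtracting the linear and the quadratic
  term along the segment leaves a function whose derivative is nonpositive by Cauchy-Schwarz and
  \<open>lip\<close>.\<close>

lemma lipschitz_gradient_upper_bound:
  fixes \<phi> :: "'a::real_inner \<Rightarrow> real"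
  assumes "convex S" and grad: "\<And>u. u \<in> S \<Longrightarrow> (\<phi> has_derivative (\<lambda>h. G u \<bullet> h)) (at u within S)"
    and lip: "\<And>u z. u \<in> S \<Longrightarrow> z \<in> S \<Longrightarrow> norm (G u - G z) \<le> L * norm (u - z)"
    and "u \<in> S" "z \<in> S"
  shows "\<phi> z \<le> \<phi> u + G u \<bullet> (z - u) + L / 2 * (norm (z - u))\<^sup>2"
proof -
  define p where "p t = u + t *\<^sub>R (z - u)" for t
  define \<psi> where "\<psi> t = \<phi> (p t) - t * (G u \<bullet> (z - u)) - L / 2 * t\<^sup>2 * (norm (z - u))\<^sup>2" for t
  have D: "(\<psi> has_real_derivative (G (p t) \<bullet> (z - u) - G u \<bullet> (z - u) - L * t * (norm (z - u))\<^sup>2))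
      (at t within {0..1})" if "t \<in> {0..1}" for t
    unfolding \<psi>_def p_def
    by (rule derivative_eq_intros gradient_along_segment[OF assms(1,2) assms(4,5) that] refl | simp)+
  have seg: "p s \<in> S" if "s \<in> {0..1}" for s
    using convexD_alt[OF assms(1,4,5), of s] that by (simp add: p_def algebra_simps)
  have neg: "G (p t) \<bullet> (z - u) - G u \<bullet> (z - u) - L * t * (norm (z - u))\<^sup>2 \<le> 0" if "t \<in> {0..1}" for t
  proof -
    have "(G (p t) - G u) \<bullet> (z - u) \<le> norm (G (p t) - G u) * norm (z - u)"
      by (rule norm_cauchy_schwarz)
    also have "\<dots> \<le> (L * norm (p t - u)) * norm (z - u)"
      using lip[OF seg[OF that] assms(4)] by (intro mult_right_mono) auto
    also have "\<dots> = L * t * (norm (z - u))\<^sup>2"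
      using that by (simp add: p_def power2_eq_square)
    finally show ?thesis by (simp add: inner_diff_left)
  qed
  have "\<psi> 1 \<le> \<psi> 0"
  proof (rule DERIV_nonpos_imp_decreasing_open[of 0 1 \<psi>])
    show "\<exists>y. (\<psi> has_real_derivative y) (at t) \<and> y \<le> 0" if "0 < t" "t < 1" for t
      using D[of t] neg[of t] that at_within_Icc_at[of 0 t 1] by fastforce
    show "continuous_on {0..1} \<psi>"
      using D by (rule DERIV_continuous_on)
  qed simp
  then show ?thesis by (simp add: \<psi>_def p_def)
qed

lemma lipschitz_gradient_lower_bound:
  fixes \<phi> :: "'a::real_inner \<Rightarrow> real"
  assumes "convex S" and grad: "\<And>u. u \<in> S \<Longrightarrow> (\<phi> has_derivative (\<lambda>h. G u \<bullet> h)) (at u within S)"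
    and lip: "\<And>u z. u \<in> S \<Longrightarrow> z \<in> S \<Longrightarrow> norm (G u - G z) \<le> L * norm (u - z)"
    and "u \<in> S" "z \<in> S"
  shows "\<phi> u + G u \<bullet> (z - u) - L / 2 * (norm (z - u))\<^sup>2 \<le> \<phi> z"
proof -
  have "((\<lambda>w. - \<phi> w) has_derivative (\<lambda>h. - G w \<bullet> h)) (at w within S)" if "w \<in> S" for w
    using has_derivative_minus[OF grad[OF that]] by simp
  from lipschitz_gradient_upper_bound[OF assms(1) this _ assms(4,5), of L] show ?thesis
    using lip by (force simp: norm_minus_commute)
qed

text \<open>Only a one-sided difference quotient at \<open>u\<close> is available. Convexity bounds
  each quotient by \<open>\<phi> z - \<phi> u\<close>, and the bound passes to the limit.\<close>

lemma convex_on_above_gradient: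
  fixes \<phi> :: "'a::real_inner \<Rightarrow> real"
  assumes "convex_on S \<phi>"
    and grad: "\<And>u. u \<in> S \<Longrightarrow> (\<phi> has_derivative (\<lambda>h. G u \<bullet> h)) (at u within S)"
    and "u \<in> S" "z \<in> S"
  shows "\<phi> u + G u \<bullet> (z - u) \<le> \<phi> z"
proof -
  have "convex S" using assms(1) by (rule convex_on_imp_convex)
  have "((\<lambda>t. (\<phi> (u + t *\<^sub>R (z - u)) - \<phi> u) / t) \<longlongrightarrow> G u \<bullet> (z - u)) (at 0 within {0..1})"
    using gradient_along_segment[OF \<open>convex S\<close> grad assms(3,4), of 0]
    by (simp add: has_field_derivative_iff)
  moreover have "\<forall>\<^sub>F t in at 0 within {0..1}. (\<phi> (u + t *\<^sub>R (z - u)) - \<phi> u) / t \<le> \<phi> z - \<phi> u"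
    unfolding eventually_at_filter
  proof (intro always_eventually allI impI)
    fix t :: real assume "t \<noteq> 0" "t \<in> {0..1}"
    then have t: "0 < t" "t \<le> 1" by auto
    have "\<phi> (u + t *\<^sub>R (z - u)) \<le> (1 - t) * \<phi> u + t * \<phi> z"
      using convex_onD[OF assms(1), of t u z] t assms(3,4) by (simp add: algebra_simps)
    then show "(\<phi> (u + t *\<^sub>R (z - u)) - \<phi> u) / t \<le> \<phi> z - \<phi> u"
      by (subst pos_divide_le_eq[OF t(1)]) (simp add: algebra_simps)
  qed
  moreover have "at 0 within {0..1::real} \<noteq> bot"
    by (simp add: at_within_Icc_at_right)
  ultimately have "G u \<bullet> (z - u) \<le> \<phi> z - \<phi> u"
    by (rule tendsto_upperbound)
  then show ?thesis by simp
qed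

text \<open>At \<open>w + t *\<^sub>R v\<close> the tangent at \<open>u\<close> is a lower bound and
  the descent lemma at \<open>w\<close> an upper one; optimize over \<open>t\<close>. The assumption
  \<open>small\<close> keeps the optimal \<open>t\<close> in the range that \<open>dir\<close>
  allows.\<close>

lemma bregman_directional_lower_bound:
  fixes \<phi> :: "'a::real_inner \<Rightarrow> real"
  assumes cvx: "convex_on S \<phi>"
    and grad: "\<And>u. u \<in> S \<Longrightarrow> (\<phi> has_derivative (\<lambda>h. G u \<bullet> h)) (at u within S)"
    and lip: "\<And>u z. u \<in> S \<Longrightarrow> z \<in> S \<Longrightarrow> norm (G u - G z) \<le> L * norm (u - z)"
    and "L > 0" and mem: "u \<in> S" "w \<in> S" and "v \<noteq> 0"
    and dir: "\<And>t. \<bar>t\<bar> \<le> \<rho> \<Longrightarrow> w + t *\<^sub>R v \<in> S" and small: "norm (w - u) \<le> \<rho> * norm v"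
  shows "((G w - G u) \<bullet> v)\<^sup>2 / (2 * L * (norm v)\<^sup>2) \<le> \<phi> w - \<phi> u - G u \<bullet> (w - u)"
proof -
  define s where "s = (G w - G u) \<bullet> v"
  \<comment> \<open>The maximizer of
    \<open>- t * s - L / 2 * t\<^sup>2 * (norm v)\<^sup>2\<close>.\<close>
  define t where "t = - s / (L * (norm v)\<^sup>2)"
  have "\<bar>s\<bar> \<le> norm (G w - G u) * norm v"
    unfolding s_def by (rule Cauchy_Schwarz_ineq2)
  also have "\<dots> \<le> (L * norm (w - u)) * norm v"
    using lip[OF mem(2,1)] by (rule mult_right_mono) simp
  also have "\<dots> \<le> (L * (\<rho> * norm v)) * norm v"
    using small \<open>L > 0\<close> by (intro mult_right_mono mult_left_mono) auto
  finally have "\<bar>s\<bar> \<le> \<rho> * (L * (norm v)\<^sup>2)"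
    by (simp add: power2_eq_square algebra_simps)
  then have "\<bar>t\<bar> \<le> \<rho>"
    using \<open>L > 0\<close> \<open>v \<noteq> 0\<close> by (simp add: t_def abs_mult divide_le_eq)
  then have z: "w + t *\<^sub>R v \<in> S" by (rule dir)
  have "\<phi> u + G u \<bullet> (w + t *\<^sub>R v - u) \<le> \<phi> (w + t *\<^sub>R v)"
    by (rule convex_on_above_gradient[OF cvx grad mem(1) z])
  also have "\<dots> \<le> \<phi> w + G w \<bullet> (w + t *\<^sub>R v - w) + L / 2 * (norm (w + t *\<^sub>R v - w))\<^sup>2"
    by (rule lipschitz_gradient_upper_bound[OF convex_on_imp_convex[OF cvx] grad lip mem(2) z])
  finally have "- t * s - L / 2 * t\<^sup>2 * (norm v)\<^sup>2 \<le> \<phi> w - \<phi> u - G u \<bullet> (w - u)"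
    by (simp add: s_def inner_simps power_mult_distrib algebra_simps)
  also have "- t * s - L / 2 * t\<^sup>2 * (norm v)\<^sup>2 = s\<^sup>2 / (2 * L * (norm v)\<^sup>2)"
    using \<open>L > 0\<close> \<open>v \<noteq> 0\<close> by (simp add: t_def field_simps power2_eq_square)
  finally show ?thesis by (simp add: s_def)
qed

text \<open>Adding the Bregman bounds for \<open>(u, w)\<close> and \<open>(w, u)\<close> cancels
  the function values and doubles the quadratic term.\<close>

lemma cocoercive_direction_local:
  fixes \<phi> :: "'a::real_inner \<Rightarrow> real"
  assumes cvx: "convex_on S \<phi>"
    and grad: "\<And>u. u \<in> S \<Longrightarrow> (\<phi> has_derivative (\<lambda>h. G u \<bullet> h)) (at u within S)"
    and lip: "\<And>u z. u \<in> S \<Longrightarrow> z \<in> S \<Longrightarrow> norm (G u - G z) \<le> L * norm (u - z)"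
    and "L > 0" and mem: "u \<in> S" "w \<in> S" and "v \<noteq> 0"
    and dir: "\<And>t. \<bar>t\<bar> \<le> \<rho> \<Longrightarrow> u + t *\<^sub>R v \<in> S" "\<And>t. \<bar>t\<bar> \<le> \<rho> \<Longrightarrow> w + t *\<^sub>R v \<in> S"
    and small: "norm (w - u) \<le> \<rho> * norm v"
  shows "((G w - G u) \<bullet> v)\<^sup>2 \<le> L * (norm v)\<^sup>2 * ((G w - G u) \<bullet> (w - u))"
proof -
  have "((G w - G u) \<bullet> v)\<^sup>2 = ((G u - G w) \<bullet> v)\<^sup>2"
    by (simp add: inner_diff_left power2_commute)
  then have "((G w - G u) \<bullet> v)\<^sup>2 / (L * (norm v)\<^sup>2) =
      ((G w - G u) \<bullet> v)\<^sup>2 / (2 * L * (norm v)\<^sup>2) + ((G u - G w) \<bullet> v)\<^sup>2 / (2 * L * (norm v)\<^sup>2)"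
    using \<open>L > 0\<close> \<open>v \<noteq> 0\<close> by (simp add: field_simps)
  also have "\<dots> \<le> (\<phi> w - \<phi> u - G u \<bullet> (w - u)) + (\<phi> u - \<phi> w - G w \<bullet> (u - w))"
    by (intro add_mono bregman_directional_lower_bound[OF cvx grad lip, where \<rho> = \<rho>])
      (use assms in \<open>auto simp: norm_minus_commute\<close>)
  also have "\<dots> = (G w - G u) \<bullet> (w - u)"
    by (simp add: inner_simps)
  finally show ?thesis
    using \<open>L > 0\<close> \<open>v \<noteq> 0\<close> by (simp add: divide_le_eq mult.commute)
qed

text \<open>
  Cocoercivity of the gradient usually requires \<open>\<phi>\<close> on the whole space, and \<open>S\<close> may even have
  empty interior. It survives when tested against a feasible direction \<open>v\<close>: shrink the segment
  towards \<open>c\<close>, so that \<open>v\<close> can be followed from all of its points, and subdivide it.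
\<close>

lemma cocoercive_direction:
  fixes \<phi> :: "'a::real_inner \<Rightarrow> real"
  assumes cvx: "convex_on S \<phi>"
    and grad: "\<And>u. u \<in> S \<Longrightarrow> (\<phi> has_derivative (\<lambda>h. G u \<bullet> h)) (at u within S)"
    and lip: "\<And>u z. u \<in> S \<Longrightarrow> z \<in> S \<Longrightarrow> norm (G u - G z) \<le> L * norm (u - z)"
    and "L > 0" and mem: "u \<in> S" "w \<in> S"
    and dir: "c + v \<in> S" "c - v \<in> S"
  shows "((G w - G u) \<bullet> v)\<^sup>2 \<le> L * (norm v)\<^sup>2 * ((G w - G u) \<bullet> (w - u))"
proof (cases "v = 0")
  case False
  have S: "convex S" using cvx by (rule convex_on_imp_convex)
  have cv: "c + t *\<^sub>R v \<in> S" if "\<bar>t\<bar> \<le> 1" for t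
  proof -
    have "((1 + t) / 2) *\<^sub>R (c + v) + ((1 - t) / 2) *\<^sub>R (c - v) \<in> S"
      using that by (intro convexD[OF S dir]) (auto simp: field_simps)
    moreover have "((1 + t) / 2) *\<^sub>R (c + v) + ((1 - t) / 2) *\<^sub>R (c - v) =
        ((1 + t) / 2 + (1 - t) / 2) *\<^sub>R c + ((1 + t) / 2 - (1 - t) / 2) *\<^sub>R v"
      by (simp only: scaleR_add_left scaleR_add_right scaleR_diff_left scaleR_diff_right) simp
    moreover have "(1 + t) / 2 + (1 - t) / 2 = 1" "(1 + t) / 2 - (1 - t) / 2 = t"
      by (simp_all add: field_simps)
    ultimately show ?thesis by simp
  qed
  have c: "c \<in> S" using cv[of 0] by simp
  \<comment> \<open>Homothety with centre \<open>c\<close> and ratio \<open>1 - \<rho>\<close>.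
    Since \<open>c\<close> has room for \<open>v\<close> on both sides, every image point has room
    for \<open>\<rho> *\<^sub>R v\<close> on both sides.\<close>
  define r where "r \<rho> a = a + \<rho> *\<^sub>R (c - a)" for \<rho> :: real and a
  have r_mem: "r \<rho> a + t *\<^sub>R v \<in> S" if "a \<in> S" "0 < \<rho>" "\<rho> \<le> 1" "\<bar>t\<bar> \<le> \<rho>" for a \<rho> t
  proof -
    have "(1 - \<rho>) *\<^sub>R a + \<rho> *\<^sub>R (c + (t / \<rho>) *\<^sub>R v) \<in> S"
      using that by (intro convexD[OF S that(1) cv]) (auto simp: abs_mult)
    then show ?thesis using that by (simp add: r_def algebra_simps)
  qed
  have shrunk: "((G (r \<rho> w) - G (r \<rho> u)) \<bullet> v)\<^sup>2
      \<le> L * (norm v)\<^sup>2 * ((G (r \<rho> w) - G (r \<rho> u)) \<bullet> (r \<rho> w - r \<rho> u))"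
    if \<rho>: "0 < \<rho>" "\<rho> \<le> 1" for \<rho>
  proof -
    \<comment> \<open>So many pieces that each is no longer than the room
      \<open>\<rho> * norm v\<close>, as the local version demands.\<close>
    obtain n :: nat where n: "norm (w - u) / (\<rho> * norm v) < real n"
      using reals_Archimedean2 by blast
    moreover have "0 \<le> norm (w - u) / (\<rho> * norm v)" using \<rho> by simp
    ultimately have n0: "n > 0" by (metis of_nat_0_less_iff order.strict_trans1)
    define z where "z i = u + (real i / real n) *\<^sub>R (w - u)" for i
    define g where "g i = G (r \<rho> (z i))" for i
    have z_mem: "z i \<in> S" if "i \<le> n" for i
      using convexD_alt[OF S mem, of "real i / real n"] that n0 by (simp add: z_def algebra_simps)
    have z_diff: "z (Suc i) - z i = (1 / real n) *\<^sub>R (w - u)" for i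
      by (simp add: z_def add_divide_distrib scaleR_add_left)
    have r_diff: "r \<rho> a - r \<rho> b = (1 - \<rho>) *\<^sub>R (a - b)" for a b
      by (simp add: r_def algebra_simps)
    have step: "((g (Suc i) - g i) \<bullet> v)\<^sup>2
        \<le> L * (norm v)\<^sup>2 * ((g (Suc i) - g i) \<bullet> ((1 / real n) *\<^sub>R (r \<rho> w - r \<rho> u)))"
      if "i < n" for i
    proof -
      have "norm (r \<rho> (z (Suc i)) - r \<rho> (z i)) = \<bar>1 - \<rho>\<bar> * (norm (w - u) / real n)"
        unfolding r_diff z_diff by simp
      also have "\<dots> \<le> 1 * (norm (w - u) / real n)"
        using \<rho> by (intro mult_right_mono) auto
      also have "\<dots> \<le> \<rho> * norm v"
        using n n0 \<rho> False by (simp add: field_simps)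
      finally have small: "norm (r \<rho> (z (Suc i)) - r \<rho> (z i)) \<le> \<rho> * norm v" .
      have zz: "z i \<in> S" "z (Suc i) \<in> S" using z_mem that by auto
      have "((g (Suc i) - g i) \<bullet> v)\<^sup>2
          \<le> L * (norm v)\<^sup>2 * ((g (Suc i) - g i) \<bullet> (r \<rho> (z (Suc i)) - r \<rho> (z i)))"
        unfolding g_def
        by (rule cocoercive_direction_local[OF cvx grad lip \<open>L > 0\<close> _ _ False r_mem r_mem small])
          (use zz \<rho> r_mem[of _ _ 0] in auto)
      also have "r \<rho> (z (Suc i)) - r \<rho> (z i) = (1 / real n) *\<^sub>R (r \<rho> w - r \<rho> u)"
        unfolding r_diff z_diff by simp
      finally show ?thesis .
    qed
    have tele: "(\<Sum>i<n. (g (Suc i) - g i) \<bullet> a) = (g n - g 0) \<bullet> a" for a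
      by (simp add: inner_sum_left[symmetric] sum_lessThan_telescope)
    have "((g n - g 0) \<bullet> v)\<^sup>2 = (\<Sum>i<n. (g (Suc i) - g i) \<bullet> v)\<^sup>2"
      by (simp only: tele)
    \<comment> \<open>Cauchy-Schwarz for \<open>n\<close> summands costs a factor \<open>n\<close>,
      which the \<open>1 / real n\<close> in \<open>step\<close> pays back.\<close>
    also have "\<dots> \<le> (\<Sum>i<n. ((g (Suc i) - g i) \<bullet> v)\<^sup>2) * real n"
      using sum_squared_le_sum_of_squares[of "\<lambda>i. (g (Suc i) - g i) \<bullet> v" "{..<n}"] by simp
    also have "\<dots> \<le> (\<Sum>i<n. L * (norm v)\<^sup>2 *
        ((g (Suc i) - g i) \<bullet> ((1 / real n) *\<^sub>R (r \<rho> w - r \<rho> u)))) * real n"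
      using step by (intro mult_right_mono sum_mono) auto
    also have "\<dots> = L * (norm v)\<^sup>2 * ((g n - g 0) \<bullet> (r \<rho> w - r \<rho> u))"
      unfolding sum_distrib_left[symmetric] tele using n0 by simp
    finally show ?thesis using n0 by (simp add: g_def z_def)
  qed
  \<comment> \<open>The shrinking parameter now tends to 0; \<open>G\<close> is Lipschitz, so the
    inequality survives in the limit.\<close>
  define l where "l n = inverse (real (Suc n))" for n
  have l: "0 < l n" "l n \<le> 1" for n
    by (auto simp: l_def field_simps)
  have "l \<longlonglongrightarrow> 0" unfolding l_def by (rule LIMSEQ_inverse_real_of_nat)
  then have r_lim: "(\<lambda>n. r (l n) a) \<longlonglongrightarrow> a" for a
    unfolding r_def by (rule tendsto_eq_rhs[OF tendsto_add[OF tendsto_const tendsto_scaleR[OF _ tendsto_const]]]) simp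
  have G_lim: "(\<lambda>n. G (r (l n) a)) \<longlonglongrightarrow> G a" if "a \<in> S" for a
  proof (rule LIM_zero_cancel, rule tendsto_norm_zero_cancel,
      rule tendsto_sandwich[OF _ _ tendsto_const])
    show "\<forall>\<^sub>F n in sequentially. norm (G (r (l n) a) - G a) \<le> L * norm (r (l n) a - a)"
      using lip r_mem[OF that l, of 0] that by (auto intro!: always_eventually simp: l less_imp_le)
    show "(\<lambda>n. L * norm (r (l n) a - a)) \<longlonglongrightarrow> 0"
      by (intro tendsto_mult_right_zero tendsto_norm_zero LIM_zero r_lim)
  qed simp
  show ?thesis
  proof (rule LIMSEQ_le)
    show "(\<lambda>n. ((G (r (l n) w) - G (r (l n) u)) \<bullet> v)\<^sup>2) \<longlonglongrightarrow> ((G w - G u) \<bullet> v)\<^sup>2"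
      by (intro tendsto_intros G_lim mem)
    show "(\<lambda>n. L * (norm v)\<^sup>2 * ((G (r (l n) w) - G (r (l n) u)) \<bullet> (r (l n) w - r (l n) u)))
        \<longlonglongrightarrow> L * (norm v)\<^sup>2 * ((G w - G u) \<bullet> (w - u))"
      by (intro tendsto_intros G_lim r_lim mem)
  qed (use shrunk l in blast)
qed simp

section \<open>Fourth roots and sums of inverse square roots\<close>

definition fourth_root :: "nat \<Rightarrow> real" where
  "fourth_root k = real k powr (1/4)"

lemma fourth_root_power4: "fourth_root k ^ 4 = real k"
  by (cases "k = 0") (simp_all add: fourth_root_def powr_power)

lemma fourth_root_nonneg [simp]: "fourth_root k \<ge> 0"
  by (simp add: fourth_root_def)

lemma fourth_root_ge_1: "k \<ge> 1 \<Longrightarrow> fourth_root k \<ge> 1"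
  by (simp add: fourth_root_def ge_one_powr_ge_zero)

lemma fourth_root_square: "(fourth_root k)\<^sup>2 = sqrt (real k)"
  by (rule real_sqrt_unique[symmetric])
    (simp_all add: fourth_root_power4 flip: power_mult)

lemma fourth_root_mono: "k \<le> l \<Longrightarrow> fourth_root k \<le> fourth_root l"
  by (simp add: fourth_root_def powr_mono2)

lemma fourth_root_le_iff_power4:
  assumes "c \<ge> 0"
  shows "fourth_root k \<le> c \<longleftrightarrow> real k \<le> c ^ 4"
  using power_mono_iff[of "fourth_root k" c 4] assms by (simp add: fourth_root_power4)

text \<open>Limits the growth of \<open>inverse (q k)\<close> to \<open>20/19 * \<zeta>\<close> per
  step, a loss that the ascent in \<open>x\<close> can absorb.\<close>

lemma fourth_root_Suc_le: "fourth_root (Suc k) \<le> fourth_root k + 1"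
proof -
  define a where "a = fourth_root k"
  have a: "a \<ge> 0" by (simp add: a_def)
  have "(a + 1) ^ 4 = a ^ 4 + 4 * a ^ 3 + 6 * a\<^sup>2 + 4 * a + 1"
    by algebra
  moreover have "a ^ 4 = real k" by (simp add: a_def fourth_root_power4)
  ultimately have "real (Suc k) \<le> (a + 1) ^ 4" using a by simp
  then show ?thesis using a by (simp add: fourth_root_le_iff_power4 flip: a_def)
qed

text \<open>The fourth powers satisfy this because \<open>(k + 2) * k \<le> (k + 1)\<^sup>2\<close>.
  It makes the ratios of consecutive \<open>q\<close> nonincreasing.\<close>

lemma fourth_root_log_concave:
  "fourth_root (Suc (Suc k)) * fourth_root k \<le> (fourth_root (Suc k))\<^sup>2"
proof (rule power_le_imp_le_base[of _ 3])
  have "real (Suc (Suc k)) * real k \<le> (real (Suc k))\<^sup>2"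
    by (simp add: power2_eq_square algebra_simps)
  moreover have "((fourth_root (Suc k))\<^sup>2) ^ Suc 3 = (fourth_root (Suc k) ^ 4)\<^sup>2"
    by (simp flip: power_mult)
  ultimately show "(fourth_root (Suc (Suc k)) * fourth_root k) ^ Suc 3 \<le> ((fourth_root (Suc k))\<^sup>2) ^ Suc 3"
    by (simp add: power_mult_distrib fourth_root_power4)
qed simp

lemma fourth_root_Suc_le_mult:
  assumes "k \<ge> 1"
  shows "fourth_root (Suc k) \<le> 2 powr (1/4) * fourth_root k"
proof -
  have "2 powr (1/4) * fourth_root k = fourth_root (2 * k)"
    by (simp add: fourth_root_def powr_mult)
  then show ?thesis using assms by (simp add: fourth_root_mono)
qed

text \<open>Telescoping of \<open>2 * (sqrt (m + 1) - sqrt m) \<le> 1 / sqrt m\<close>. For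
  \<open>N > M\<close> the sum is empty and the left side is at most 0, which spares the counting
  argument a case distinction.\<close>

lemma sum_inverse_sqrt_lower_bound:
  "2 * (sqrt (real M + 2) - sqrt (real N + 1)) \<le> (\<Sum>k=N..M. 1 / sqrt (real k + 1))"
proof (induction M)
  case 0
  have "sqrt 2 \<le> 3 / 2"
    by (rule real_le_lsqrt) (auto simp: power2_eq_square)
  moreover have "sqrt 2 \<le> sqrt (real N + 1)" if "N > 0"
    using that by (intro real_sqrt_le_mono) simp
  ultimately show ?case by (cases "N = 0") auto
next
  case (Suc M)
  show ?case
  proof (cases "N \<le> Suc M")
    case True
    define a where "a = sqrt (real M + 2)"
    define b where "b = sqrt (real M + 3)"
    have a: "a > 0" "a\<^sup>2 = real M + 2" and b: "b \<ge> 0" "b\<^sup>2 = real M + 3" by (auto simp: a_def b_def)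
    have "2 * a * b \<le> a\<^sup>2 + b\<^sup>2" by (rule sum_squares_bound)
    then have "2 * (b - a) * a \<le> 1" using a b by (simp add: algebra_simps power2_eq_square)
    then have "2 * (b - a) \<le> 1 / a" using a by (simp add: le_divide_eq)
    moreover have "(\<Sum>k=N..Suc M. 1 / sqrt (real k + 1)) = (\<Sum>k=N..M. 1 / sqrt (real k + 1)) + 1 / a"
      using True by (simp add: a_def add.commute)
    moreover have "sqrt (real (Suc M) + 2) = b" by (simp add: b_def add.commute)
    ultimately show ?thesis using Suc.IH by (simp add: a_def algebra_simps)
  next
    case False
    then have "sqrt (real (Suc M) + 2) \<le> sqrt (real N + 1)"
      by (intro real_sqrt_le_mono) linarith
    moreover have "{N..Suc M} = {}" using False by auto
    ultimately show ?thesis by (simp del: of_nat_Suc)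
  qed
qed

section \<open>Ascent of the potential\<close>

text \<open>
  The ascent in \<open>x\<close> with all inner products of the iterates as real parameters: \<open>Z = 1/\<zeta>\<close>, \<open>A\<close>, \<open>B\<close>,
  \<open>V\<close> are the squared norms of the new step, the old step and their difference, \<open>E1\<close>, \<open>E2\<close> absorb the
  old step in \<open>y\<close>, and \<open>opt\<close> (the two optimality conditions added) is used \<open>M\<close> times.
\<close>

lemma ascent_algebra:
  fixes Z i ip q q' M :: real
  assumes f: "ea + hh + ga \<le> df"
    and ga: "- q' * (xa - ba) - Z * ba \<le> ga"
    and opt: "ea + hh + q * xa - q' * (xa - ba) + Z * (A - ba) \<le> 0"
    and ea: "- E1 - Z / 2 * A \<le> ea" "- E2 - 4 * Z * A \<le> M * ea"
    and hh: "- Z / 40 * V \<le> hh"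
    and ba: "2 * ba = A + B - V" and xa: "2 * xa = N1 - N0 - A"
    and M: "M = 16 * Z * i" and qi: "q * i = 1"
    and nonneg: "A \<ge> 0" "B \<ge> 0" "V \<ge> 0" "Z \<ge> 0" "i \<ge> 0" "q \<ge> 0"
    and q': "q \<le> q'"
    and cV: "0 \<le> 19/40 * (M * Z) + 19/40 * Z - q' / 2 - 8 * Z * (q' * i)"
    and loss: "Z\<^sup>2 * ip \<le> Z\<^sup>2 * i + 20/19 * Z"
  shows "9/10 * Z * A - 8 * Z * (q' * i - q * ip) * N1 - (q' - q) / 2 * N1
    \<le> df - 8 * Z\<^sup>2 * ip * A + 8 * Z\<^sup>2 * i * B + 8 * Z * (q * ip - 1) * N1
      - 8 * Z * (q' * i - 1) * N0 + 15/2 * Z * (A - B) + q / 2 * N1 - q' / 2 * N0 + E1 + E2"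
proof -
  define r where "r = q' * i"
  have r: "r \<ge> 1" using mult_right_mono[OF q' nonneg(5)] by (simp add: r_def qi)
  have M0: "M \<ge> 0" using nonneg by (simp add: M)
  \<comment> \<open>The weight \<open>M\<close> turns the regularization coefficients
    \<open>q\<close> and \<open>q'\<close> into \<open>16 * Z\<close> and \<open>16 * Z * r\<close>,
    where \<open>r\<close> is the ratio \<open>q' / q\<close> that enters the potential.\<close>
  have Mq: "M * q = 16 * Z" "M * q' = 16 * Z * r"
    using qi by (simp_all add: M r_def algebra_simps)
  have "M * (ea + hh + q * xa - q' * (xa - ba) + Z * (A - ba)) \<le> 0"
    using mult_left_mono[OF opt M0] by simp
  moreover have "M * (ea + hh + q * xa - q' * (xa - ba) + Z * (A - ba)) =
      M * ea + M * hh + (M * q) * xa - (M * q') * (xa - ba) + M * Z * (A - ba)"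
    by (simp add: algebra_simps)
  ultimately have opt': "M * ea + M * hh + 16 * Z * xa - 16 * Z * r * (xa - ba) + M * Z * (A - ba) \<le> 0"
    by (simp add: Mq)
  have hh': "- (M * Z) / 40 * V \<le> M * hh"
    using mult_left_mono[OF hh M0] by (simp add: algebra_simps)
  have ba: "ba = (A + B - V) / 2" and xa: "xa = (N1 - N0 - A) / 2"
    using ba xa by auto
  \<comment> \<open>In \<open>cA\<close>, \<open>cB\<close> and \<open>cV'\<close> stand the
    coefficients of \<open>A\<close>, \<open>B\<close> and \<open>V\<close> that remain when all
    estimates are added up, for \<open>A\<close> after an application of
    \<open>loss\<close>.\<close>
  have cA: "0 \<le> (8/5 * Z + 16 * Z * r - 8 * Z + q' - 8 * (20/19 * Z)) * A"
  proof (intro mult_nonneg_nonneg)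
    have "Z * 1 \<le> Z * r" using r nonneg by (intro mult_left_mono) auto
    then show "0 \<le> 8/5 * Z + 16 * Z * r - 8 * Z + q' - 8 * (20/19 * Z)"
      using nonneg q' by linarith
  qed (use nonneg in auto)
  have lossA: "8 * (Z\<^sup>2 * ip) * A \<le> 8 * (Z\<^sup>2 * i + 20/19 * Z) * A"
    using loss nonneg by (intro mult_right_mono) auto
  have cB: "0 \<le> (q' / 2 - 8 * Z + 8 * Z * r) * B"
  proof (intro mult_nonneg_nonneg)
    have "Z * 1 \<le> Z * r" using r nonneg by (intro mult_left_mono) auto
    then show "0 \<le> q' / 2 - 8 * Z + 8 * Z * r"
      using nonneg q' by linarith
  qed (use nonneg in auto)
  have cV': "0 \<le> (19/40 * (M * Z) + 19/40 * Z - q' / 2 - 8 * Z * r) * V"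
    using cV nonneg by (intro mult_nonneg_nonneg) (auto simp: r_def)
  have MZ: "M * Z = 16 * (Z\<^sup>2 * i)" by (simp add: M power2_eq_square)
  show ?thesis
    using f ga ea opt' hh hh' cA cB cV' lossA
    unfolding ba xa r_def[symmetric] MZ
    by (simp add: algebra_simps add_divide_distrib diff_divide_distrib)
qed

section \<open>The iteration: partial gradients, feasibility, optimality in \<open>x\<close>\<close>

locale convex_nonconcave_agp =
  fixes X :: "'a::euclidean_space set" and Y :: "'b::euclidean_space set"
    and f :: "'a \<Rightarrow> 'b \<Rightarrow> real"
    and gx :: "'a \<Rightarrow> 'b \<Rightarrow> 'a" and gy :: "'a \<Rightarrow> 'b \<Rightarrow> 'b"
    and L11 L12 L21 L22 \<zeta> \<nu> \<tau> :: real
    and x :: "nat \<Rightarrow> 'a" and y :: "nat \<Rightarrow> 'b"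
  assumes X: "X \<noteq> {}" "closed X" "bounded X" "convex X"
    and Y: "Y \<noteq> {}" "closed Y" "bounded Y" "convex Y"
    and grad: "has_gradient_blocks f gx gy X Y"
    and cvx: "\<And>v. v \<in> Y \<Longrightarrow> convex_on X (\<lambda>u. f u v)"
    and L_pos: "L11 > 0" "L12 > 0" "L21 > 0" "L22 > 0"
    and lip: "lipschitz_gradient gx gy X Y L11 L12 L21 L22"
    and \<zeta>: "\<zeta> > 0" "\<zeta> \<le> 1 / (10 * L11)"
    and \<nu>: "\<nu> > 0"
    and \<tau>: "\<tau> > max (19\<^sup>2 * (L22 + 2 * \<nu> - \<zeta> * L21\<^sup>2) / (20\<^sup>2 * 16 * \<zeta> * L21\<^sup>2)) 2"
    and iter: "agp_iterates X Y gx gy \<zeta> (q_par \<zeta>) (gamma_par \<zeta> \<nu> \<tau> L21) x y"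
begin

abbreviation "q \<equiv> q_par \<zeta>"
abbreviation "\<gamma> \<equiv> gamma_par \<zeta> \<nu> \<tau> L21"
abbreviation "p \<equiv> p_par \<zeta> \<tau> L21"
abbreviation "\<sigma> \<equiv> sigma_x X"

lemma f_has_derivative_fst:
  assumes "u \<in> X" "v \<in> Y"
  shows "((\<lambda>u. f u v) has_derivative (\<lambda>h. gx u v \<bullet> h)) (at u within X)"
proof -
  have "((\<lambda>u. (u, v)) has_derivative (\<lambda>h. (h, 0))) (at u within X)"
    by (auto intro!: derivative_eq_intros)
  moreover have "((\<lambda>(u, v). f u v) has_derivative (\<lambda>(h, k). gx u v \<bullet> h + gy u v \<bullet> k))
      (at (u, v) within (\<lambda>u. (u, v)) ` X)"
    by (rule has_derivative_subset[where s = "X \<times> Y"])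
      (use grad assms in \<open>auto simp: has_gradient_blocks_def\<close>)
  ultimately show ?thesis
    by (auto dest: has_derivative_in_compose)
qed

lemma f_has_derivative_snd:
  assumes "u \<in> X" "v \<in> Y"
  shows "((\<lambda>v. f u v) has_derivative (\<lambda>k. gy u v \<bullet> k)) (at v within Y)"
proof -
  have "((\<lambda>v. (u, v)) has_derivative (\<lambda>k. (0, k))) (at v within Y)"
    by (auto intro!: derivative_eq_intros)
  moreover have "((\<lambda>(u, v). f u v) has_derivative (\<lambda>(h, k). gx u v \<bullet> h + gy u v \<bullet> k))
      (at (u, v) within (\<lambda>v. (u, v)) ` Y)"
    by (rule has_derivative_subset[where s = "X \<times> Y"])
      (use grad assms in \<open>auto simp: has_gradient_blocks_def\<close>)
  ultimately show ?thesis
    by (auto dest: has_derivative_in_compose)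
qed

lemma lip_xx: "u \<in> X \<Longrightarrow> w \<in> X \<Longrightarrow> v \<in> Y \<Longrightarrow> norm (gx u v - gx w v) \<le> L11 * norm (u - w)"
  and lip_xy: "u \<in> X \<Longrightarrow> v \<in> Y \<Longrightarrow> z \<in> Y \<Longrightarrow> norm (gx u v - gx u z) \<le> L21 * norm (v - z)"
  and lip_yy: "u \<in> X \<Longrightarrow> v \<in> Y \<Longrightarrow> z \<in> Y \<Longrightarrow> norm (gy u v - gy u z) \<le> L22 * norm (v - z)"
  and lip_yx: "u \<in> X \<Longrightarrow> w \<in> X \<Longrightarrow> v \<in> Y \<Longrightarrow> norm (gy u v - gy w v) \<le> L12 * norm (u - w)"
  using lip Y(1) X(1) unfolding lipschitz_gradient_def by blast+

lemma x_1: "x 1 \<in> X" and y_1: "y 1 \<in> Y"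
  and x_Suc: "k \<ge> 1 \<Longrightarrow> x (Suc k) = closest_point X (x k - \<zeta> *\<^sub>R gx (x k) (y k) - (\<zeta> * q k) *\<^sub>R x k)"
  and y_Suc: "k \<ge> 1 \<Longrightarrow> y (Suc k) = closest_point Y (y k + (1 / \<gamma> k) *\<^sub>R gy (x (Suc k)) (y k))"
  using iter by (auto simp: agp_iterates_def)

lemma x_mem: "k \<ge> 1 \<Longrightarrow> x k \<in> X"
  by (induction k rule: dec_induct) (auto simp: x_1 x_Suc closest_point_in_set X simp del: One_nat_def)

lemma y_mem: "k \<ge> 1 \<Longrightarrow> y k \<in> Y"
  by (induction k rule: dec_induct) (auto simp: y_1 y_Suc closest_point_in_set Y simp del: One_nat_def)

text \<open>The obtuse angle characterization of the projection, divided by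
  \<open>\<zeta>\<close>.\<close>

lemma x_optimality:
  assumes "k \<ge> 1" "u \<in> X"
  shows "0 \<le> (gx (x k) (y k) + q k *\<^sub>R x k + (1 / \<zeta>) *\<^sub>R (x (Suc k) - x k)) \<bullet> (u - x (Suc k))"
proof -
  have "(x k - \<zeta> *\<^sub>R gx (x k) (y k) - (\<zeta> * q k) *\<^sub>R x k - x (Suc k)) \<bullet> (u - x (Suc k)) \<le> 0"
    using closest_point_dot[OF X(4,2) assms(2)] by (simp only: x_Suc[OF assms(1)])
  also have "x k - \<zeta> *\<^sub>R gx (x k) (y k) - (\<zeta> * q k) *\<^sub>R x k - x (Suc k) =
      (- \<zeta>) *\<^sub>R (gx (x k) (y k) + q k *\<^sub>R x k + (1 / \<zeta>) *\<^sub>R (x (Suc k) - x k))"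
    using \<zeta>(1) by (simp add: algebra_simps)
  finally show ?thesis
    using \<zeta>(1) by (simp add: mult_le_0_iff zero_le_mult_iff)
qed

section \<open>Size and monotonicity of the parameter sequences\<close>

lemma q_eq: "q k = 19 / (20 * \<zeta> * fourth_root k)"
  by (simp add: q_par_def fourth_root_def)

lemma q_pos: "k \<ge> 1 \<Longrightarrow> q k > 0"
  using \<zeta>(1) by (simp add: q_par_def)

lemma inverse_q: "inverse (q k) = 20/19 * \<zeta> * fourth_root k"
  by (simp add: q_eq)

lemma q_square: "(q k)\<^sup>2 = 361 / (400 * \<zeta>\<^sup>2 * sqrt (real k))"
  by (simp add: q_eq power_divide power_mult_distrib fourth_root_square)

lemma q_antimono: "k \<ge> 1 \<Longrightarrow> q (Suc k) \<le> q k"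
  unfolding q_eq using \<zeta>(1) fourth_root_ge_1[of k] fourth_root_mono[of k "Suc k"]
  by (intro divide_left_mono mult_left_mono mult_pos_pos) auto

lemma q_ratio: "q k / q (Suc k) = fourth_root (Suc k) / fourth_root k"
  using \<zeta>(1) by (simp add: q_eq field_simps)

text \<open>Fixes the sign of a coefficient in \<open>potential_ascent\<close>, so that the squared
  norm there may be replaced by \<open>\<sigma>\<^sup>2\<close>.\<close>

lemma q_ratio_antimono:
  assumes "k \<ge> 1"
  shows "q (Suc k) / q (Suc (Suc k)) \<le> q k / q (Suc k)"
  using fourth_root_log_concave[of k] fourth_root_ge_1[of k] fourth_root_ge_1[of "Suc k"] assms
  by (simp add: q_ratio divide_simps power2_eq_square)

lemma q_ratio_le: "k \<ge> 1 \<Longrightarrow> q k / q (Suc k) \<le> 2 powr (1/4)"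
  using fourth_root_Suc_le_mult[of k] fourth_root_ge_1[of k] by (simp add: q_ratio divide_simps)

lemma q_1: "q 1 = 19 / (20 * \<zeta>)"
  by (simp add: q_par_def)

lemma q_le_q_1: "k \<ge> 1 \<Longrightarrow> q k \<le> 19 / (20 * \<zeta>)"
  unfolding q_eq using \<zeta>(1) fourth_root_ge_1[of k]
  by (intro divide_left_mono) auto

lemma tau_gt_2: "\<tau> > 2"
  using \<tau> by simp

text \<open>The lower bound on \<open>\<tau>\<close> is the strict form of this inequality without
  the factor \<open>sqrt (real (Suc k)) \<ge> 1\<close>.\<close>

lemma L22_le_gammabar:
  assumes "k \<ge> 1"
  shows "L22 \<le> gammabar_par \<zeta> \<nu> \<tau> L21 k"
proof -
  define c where "c = L22 + 2 * \<nu> - \<zeta> * L21\<^sup>2"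
  define w where "w = 16 * \<zeta> * L21\<^sup>2 * 20\<^sup>2 / 19\<^sup>2"
  have w: "w > 0" using \<zeta> L_pos by (simp add: w_def)
  have "c / w < \<tau>" using \<tau> \<zeta> L_pos by (simp add: c_def w_def field_simps)
  then have "c \<le> \<tau> * w" using w by (simp add: divide_less_eq)
  also have "\<dots> \<le> \<tau> * w * sqrt (real (Suc k))"
    using w tau_gt_2 mult_left_mono[of 1 "sqrt (real (Suc k))" "\<tau> * w"] by simp
  also have "\<dots> = 16 * \<tau> * L21\<^sup>2 / (\<zeta> * (q (k + 1))\<^sup>2)"
    unfolding w_def q_square using \<zeta>(1) by (simp add: power2_eq_square)
  finally show ?thesis by (simp add: c_def gammabar_par_def)
qed

lemma gamma_pos: "k \<ge> 1 \<Longrightarrow> \<gamma> k > 0"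
  using L22_le_gammabar[of k] \<nu> L_pos by (simp add: gamma_par_def)

lemma p_eq: "p k = 3200 * \<zeta> * (\<tau> - 2) * L21\<^sup>2 * sqrt (real (Suc k)) / 361"
  using \<zeta>(1) unfolding p_par_def q_square by (simp add: field_simps power2_eq_square)

lemma p_pos: "p k > 0"
  using \<zeta>(1) tau_gt_2 L_pos by (simp add: p_eq)

lemma p_mono: "k \<le> l \<Longrightarrow> p k \<le> p l"
  using \<zeta>(1) tau_gt_2 L_pos unfolding p_eq
  by (intro divide_right_mono mult_left_mono) auto

text \<open>The projection gives \<open>\<gamma> k * (norm c)\<^sup>2 \<le> g \<bullet> c\<close>
  for the step \<open>c\<close>; the quadratic lower bound for \<open>f\<close> costs only
  \<open>L22 / 2\<close> of this.\<close>

lemma y_ascent: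
  assumes "k \<ge> 1"
  shows "(\<zeta> * L21\<^sup>2 / 2 + 16 * L21\<^sup>2 / (\<zeta> * (q (Suc k))\<^sup>2) + p k) * (norm (y (Suc k) - y k))\<^sup>2
    \<le> f (x (Suc k)) (y (Suc k)) - f (x (Suc k)) (y k)"
proof -
  have mem: "x (Suc k) \<in> X" "y k \<in> Y" "y (Suc k) \<in> Y"
    using x_mem y_mem assms by auto
  define c where "c = y (Suc k) - y k"
  define g where "g = gy (x (Suc k)) (y k)"
  have \<gamma>: "\<gamma> k > 0" by (rule gamma_pos[OF assms])
  have "(y k + (1 / \<gamma> k) *\<^sub>R g - y (Suc k)) \<bullet> (y k - y (Suc k)) \<le> 0"
    using closest_point_dot[OF Y(4,2) mem(2)] by (simp only: y_Suc[OF assms] g_def)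
  then have "((1 / \<gamma> k) *\<^sub>R g - c) \<bullet> c \<ge> 0"
    by (simp add: c_def inner_diff_left inner_diff_right inner_add_left)
  then have "(c \<bullet> c) * \<gamma> k \<le> g \<bullet> c"
    using \<gamma> by (simp add: inner_diff_left le_divide_eq)
  then have opt: "\<gamma> k * (norm c)\<^sup>2 \<le> g \<bullet> c"
    by (simp add: power2_norm_eq_inner mult.commute)
  have "f (x (Suc k)) (y k) + g \<bullet> c - L22 / 2 * (norm c)\<^sup>2 \<le> f (x (Suc k)) (y (Suc k))"
    unfolding g_def c_def
    by (rule lipschitz_gradient_lower_bound[OF Y(4) f_has_derivative_snd lip_yy]) (use mem in auto)
  then have "(\<gamma> k - L22 / 2) * (norm c)\<^sup>2 \<le> f (x (Suc k)) (y (Suc k)) - f (x (Suc k)) (y k)"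
    using opt by (simp add: algebra_simps)
  \<comment> \<open>\<open>p k\<close> is what is left after reserving the two other terms, which
    the potential subtracts and the next step in \<open>x\<close> consumes as \<open>E1\<close> and
    \<open>E2\<close>.\<close>
  moreover have "\<zeta> * L21\<^sup>2 / 2 + 16 * L21\<^sup>2 / (\<zeta> * (q (Suc k))\<^sup>2) + p k =
      \<nu> + gammabar_par \<zeta> \<nu> \<tau> L21 k / 2"
    by (simp add: p_par_def gammabar_par_def diff_divide_distrib add_divide_distrib algebra_simps)
  then have "\<zeta> * L21\<^sup>2 / 2 + 16 * L21\<^sup>2 / (\<zeta> * (q (Suc k))\<^sup>2) + p k \<le> \<gamma> k - L22 / 2"
    using L22_le_gammabar[OF assms] by (simp add: gamma_par_def)
  then have "(\<zeta> * L21\<^sup>2 / 2 + 16 * L21\<^sup>2 / (\<zeta> * (q (Suc k))\<^sup>2) + p k) * (norm c)\<^sup>2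
      \<le> (\<gamma> k - L22 / 2) * (norm c)\<^sup>2"
    by (rule mult_right_mono) simp
  ultimately show ?thesis by (simp add: c_def)
qed

text \<open>Split \<open>z - w\<close> into \<open>w - u\<close> and \<open>d\<close>. The first
  part contributes \<open>hb \<ge> 0\<close> by monotonicity of the gradient, and cocoercivity along
  \<open>d\<close> controls the contribution \<open>s\<close> of the second by \<open>hb\<close> and
  \<open>V\<close>.\<close>

lemma gradient_change_bound:
  assumes "u \<in> X" "w \<in> X" "z \<in> X" "v \<in> Y"
  shows "- (norm (z - w - (w - u)))\<^sup>2 / (40 * \<zeta>) \<le> (gx w v - gx u v) \<bullet> (z - w)"
proof -
  define d where "d = z - w - (w - u)"
  define h where "h = gx w v - gx u v"
  define s where "s = h \<bullet> d"
  define V where "V = (norm d)\<^sup>2"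
  define hb where "hb = h \<bullet> (w - u)"
  note X_grad = f_has_derivative_fst[OF _ assms(4)]
  have hb: "hb \<ge> 0"
    using convex_on_above_gradient[OF cvx[OF assms(4)] X_grad assms(1,2)]
      convex_on_above_gradient[OF cvx[OF assms(4)] X_grad assms(2,1)]
    by (simp add: hb_def h_def inner_simps)
  \<comment> \<open>The centroid of \<open>u\<close>, \<open>w\<close>, \<open>z\<close>: moving
    from it by a sixth of \<open>d\<close> in either direction stays within their convex
    hull.\<close>
  define c where "c = (1/3) *\<^sub>R u + (1/3) *\<^sub>R w + (1/3) *\<^sub>R z"
  have comb: "\<alpha> *\<^sub>R u + \<beta> *\<^sub>R w + \<delta> *\<^sub>R z \<in> X"
    if "0 \<le> \<alpha>" "0 \<le> \<beta>" "0 \<le> \<delta>" "\<alpha> + \<beta> + \<delta> = 1" for \<alpha> \<beta> \<delta>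
  proof -
    have "\<alpha> *\<^sub>R u + \<beta> *\<^sub>R w + \<delta> *\<^sub>R z \<in> convex hull {u, w, z}"
      using that by (auto simp: convex_hull_3)
    also have "\<dots> \<subseteq> X"
      using assms X(4) by (intro hull_minimal) auto
    finally show ?thesis .
  qed
  have "c + (1/6) *\<^sub>R d = (1/2) *\<^sub>R u + 0 *\<^sub>R w + (1/2) *\<^sub>R z"
    "c - (1/6) *\<^sub>R d = (1/6) *\<^sub>R u + (2/3) *\<^sub>R w + (1/6) *\<^sub>R z"
    by (simp_all add: c_def d_def euclidean_eq_iff[where 'a = 'a] inner_simps field_simps)
  then have "c + (1/6) *\<^sub>R d \<in> X" "c - (1/6) *\<^sub>R d \<in> X"
    using comb[of "1/2" 0 "1/2"] comb[of "1/6" "2/3" "1/6"] by simp_all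
  then have "(h \<bullet> ((1/6) *\<^sub>R d))\<^sup>2 \<le> L11 * (norm ((1/6) *\<^sub>R d))\<^sup>2 * hb"
    unfolding h_def hb_def
    by (intro cocoercive_direction[OF cvx[OF assms(4)] X_grad lip_xx[OF _ _ assms(4)] L_pos(1) assms(1,2)])
  then have "s\<^sup>2 \<le> L11 * V * hb"
    by (simp add: s_def V_def power_mult_distrib power_divide)
  also have "\<dots> \<le> 1 / (10 * \<zeta>) * V * hb"
    using \<zeta> L_pos hb by (intro mult_right_mono) (auto simp: V_def field_simps)
  finally have s: "10 * \<zeta> * s\<^sup>2 \<le> V * hb"
    using \<zeta>(1) by (simp add: field_simps)
  have "0 \<le> hb + s + V / (40 * \<zeta>)"
  proof (cases "V = 0")
    case True
    then have "s = 0" by (simp add: V_def s_def)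
    then show ?thesis using hb True by simp
  next
    case False
    then have "V > 0" by (simp add: V_def)
    \<comment> \<open>Completing the square: \<open>40 * \<zeta> * V\<close> times the claimed
      quantity dominates this square.\<close>
    have "0 \<le> (20 * \<zeta> * s + V)\<^sup>2" by simp
    also have "\<dots> = 40 * \<zeta> * (10 * \<zeta> * s\<^sup>2) + 40 * \<zeta> * s * V + V\<^sup>2"
      by algebra
    also have "\<dots> \<le> 40 * \<zeta> * (V * hb) + 40 * \<zeta> * s * V + V\<^sup>2"
      using s \<zeta>(1) by simp
    also have "\<dots> = V * (40 * \<zeta>) * (hb + s + V / (40 * \<zeta>))"
      using \<zeta>(1) by (simp add: field_simps power2_eq_square)
    finally show ?thesis
      using mult_pos_pos[OF \<open>V > 0\<close> \<zeta>(1)] by (auto simp: zero_le_mult_iff)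
  qed
  moreover have "h \<bullet> (z - w) = hb + s"
    by (simp add: hb_def s_def d_def inner_simps)
  ultimately show ?thesis by (simp add: V_def h_def d_def)
qed

text \<open>\<open>potential k\<close> is the paper's \<open>F\<close> at index \<open>k + 1\<close>, which avoids a predecessor on indices.\<close>

definition potential :: "nat \<Rightarrow> real" where
  "potential k = f (x (Suc k)) (y (Suc k))
    - 8 / (\<zeta>\<^sup>2 * q (Suc k)) * (norm (x (Suc k) - x k))\<^sup>2
    - 8 / \<zeta> * (1 - q k / q (Suc k)) * (norm (x (Suc k)))\<^sup>2
    + 15 / (2 * \<zeta>) * (norm (x (Suc k) - x k))\<^sup>2
    + q k / 2 * (norm (x (Suc k)))\<^sup>2
    - (\<zeta> * L21\<^sup>2 / 2 + 16 * L21\<^sup>2 / (\<zeta> * (q (Suc k))\<^sup>2)) * (norm (y (Suc k) - y k))\<^sup>2"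

definition progress :: "nat \<Rightarrow> real" where
  "progress k = 9 / (10 * \<zeta>) * (norm (x (Suc k) - x k))\<^sup>2 + p k * (norm (y (Suc k) - y k))\<^sup>2"

lemma potential_1: "potential 1 = F2_const f \<zeta> L21 x y"
  by (simp add: potential_def F2_const_def numeral_2_eq_2)

lemma norm_le_sigma: "u \<in> X \<Longrightarrow> norm u \<le> \<sigma>"
  unfolding sigma_x_def using X(3) by (intro cSUP_upper) (auto simp: bounded_iff bdd_above_def)

lemma norm_square_le_sigma: "u \<in> X \<Longrightarrow> (norm u)\<^sup>2 \<le> \<sigma>\<^sup>2"
  using norm_le_sigma by (intro power_mono) auto

lemma f_le_f_max:
  assumes "u \<in> X" "v \<in> Y"
  shows "f u v \<le> f_max f X Y"
proof -
  have "continuous_on (X \<times> Y) (\<lambda>(u, v). f u v)"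
    using grad unfolding has_gradient_blocks_def continuous_on_eq_continuous_within
    by (auto intro!: has_derivative_continuous)
  moreover have "compact (X \<times> Y)"
    using X Y by (intro compact_Times) (auto simp: compact_eq_bounded_closed)
  ultimately have "bdd_above ((\<lambda>(u, v). f u v) ` (X \<times> Y))"
    by (intro bounded_imp_bdd_above compact_imp_bounded compact_continuous_image)
  from cSUP_upper[OF _ this, of "(u, v)"] assms show ?thesis
    by (simp add: f_max_def)
qed

text \<open>Adds \<open>y_ascent\<close> to \<open>ascent_algebra\<close>, which combines the
  optimality of two consecutive steps in \<open>x\<close>. The errors left over have nonnegative
  coefficients, so \<open>\<sigma>\<^sup>2\<close> may replace the squared norm in them, and they
  telescope.\<close>

lemma potential_ascent:
  assumes "j \<ge> 1"
  shows "progress (Suc j) - 8 / \<zeta> * (q j / q (Suc j) - q (Suc j) / q (Suc (Suc j))) * \<sigma>\<^sup>2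
      - (q j - q (Suc j)) / 2 * \<sigma>\<^sup>2 \<le> potential (Suc j) - potential j"
proof -
  define k where "k = Suc j"
  have k: "k \<ge> 1" by (simp add: k_def)
  have mem: "x j \<in> X" "x k \<in> X" "x (Suc k) \<in> X" "y j \<in> Y" "y k \<in> Y" "y (Suc k) \<in> Y"
    using x_mem y_mem assms by (auto simp: k_def)
  define a where "a = x (Suc k) - x k"
  define b where "b = x k - x j"
  define e where "e = gx (x k) (y k) - gx (x k) (y j)"
  define h where "h = gx (x k) (y j) - gx (x j) (y j)"
  define Z where "Z = 1 / \<zeta>"
  define i where "i = inverse (q k)"
  define ip where "ip = inverse (q (Suc k))"
  define M where "M = 16 * Z * i"
  define D where "D = (norm (y k - y j))\<^sup>2"
  define N1 where "N1 = (norm (x (Suc k)))\<^sup>2"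
  define E1 where "E1 = \<zeta> * L21\<^sup>2 / 2 * D"
  define E2 where "E2 = 16 * L21\<^sup>2 / (\<zeta> * (q k)\<^sup>2) * D"
  have Z: "Z > 0" "Z * \<zeta> = 1" using \<zeta>(1) by (auto simp: Z_def)
  have qk: "q k > 0" "q j > 0" "q (Suc k) > 0" using q_pos assms k by auto
  have \<kappa>: "fourth_root j \<ge> 1" using assms by (rule fourth_root_ge_1)
  have "norm e \<le> L21 * norm (y k - y j)"
    unfolding e_def using mem by (intro lip_xy)
  then have ea_abs: "\<bar>e \<bullet> a\<bar> \<le> L21 * norm (y k - y j) * norm a"
    using Cauchy_Schwarz_ineq2[of e a] mult_right_mono[of "norm e" "L21 * norm (y k - y j)" "norm a"] by simp
  \<comment> \<open>Young's inequality, balanced so that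
    \<open>c * L21 = 2 * sqrt \<alpha> * sqrt \<beta>\<close>. It serves for
    \<open>e \<bullet> a\<close> and for its multiple by \<open>M\<close>.\<close>
  have young: "c * \<bar>e \<bullet> a\<bar> \<le> \<alpha> * D + \<beta> * (norm a)\<^sup>2"
    if "c \<ge> 0" "\<alpha> \<ge> 0" "\<beta> \<ge> 0" "(c * L21)\<^sup>2 = 4 * \<alpha> * \<beta>" for c \<alpha> \<beta>
  proof -
    have "c * L21 = sqrt ((c * L21)\<^sup>2)" using that(1) L_pos by simp
    also have "\<dots> = 2 * sqrt \<alpha> * sqrt \<beta>" using that by (simp add: real_sqrt_mult)
    finally have c: "c * L21 = 2 * sqrt \<alpha> * sqrt \<beta>" .
    have "c * \<bar>e \<bullet> a\<bar> \<le> c * (L21 * norm (y k - y j) * norm a)"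
      using ea_abs that(1) by (rule mult_left_mono)
    also have "\<dots> = (c * L21) * norm (y k - y j) * norm a" by simp
    also have "\<dots> = 2 * (sqrt \<alpha> * norm (y k - y j)) * (sqrt \<beta> * norm a)"
      unfolding c by simp
    also have "\<dots> \<le> (sqrt \<alpha> * norm (y k - y j))\<^sup>2 + (sqrt \<beta> * norm a)\<^sup>2"
      by (rule sum_squares_bound)
    finally show ?thesis using that by (simp add: D_def power_mult_distrib)
  qed
  have coeffs: "8 / (\<zeta>\<^sup>2 * t) = 8 * Z\<^sup>2 * inverse t" "15 / (2 * \<zeta>) = 15/2 * Z" "8 / \<zeta> = 8 * Z"
    "9 / (10 * \<zeta>) = 9/10 * Z" for t
    by (simp_all add: Z_def field_simps)
  have "9/10 * Z * (norm a)\<^sup>2 - 8 * Z * (q j * i - q k * ip) * N1 - (q j - q k) / 2 * N1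
    \<le> (f (x (Suc k)) (y k) - f (x k) (y k)) - 8 * Z\<^sup>2 * ip * (norm a)\<^sup>2 + 8 * Z\<^sup>2 * i * (norm b)\<^sup>2
      + 8 * Z * (q k * ip - 1) * N1 - 8 * Z * (q j * i - 1) * (norm (x k))\<^sup>2
      + 15/2 * Z * ((norm a)\<^sup>2 - (norm b)\<^sup>2) + q k / 2 * N1 - q j / 2 * (norm (x k))\<^sup>2 + E1 + E2"
  proof (rule ascent_algebra[where M = M])
    \<comment> \<open>The tangent at \<open>x k\<close> bounds the gain in \<open>x\<close>;
      \<open>e\<close> and \<open>h\<close> are the changes of the gradient caused by the previous
      steps in \<open>y\<close> and in \<open>x\<close>.\<close>
    show "e \<bullet> a + h \<bullet> a + gx (x j) (y j) \<bullet> a \<le> f (x (Suc k)) (y k) - f (x k) (y k)"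
      using convex_on_above_gradient[OF cvx[OF mem(5)] f_has_derivative_fst[OF _ mem(5)] mem(2,3)]
      by (simp add: e_def h_def a_def inner_simps)
    \<comment> \<open>The previous step is tested at the new iterate, and further down the new step
      at the old one.\<close>
    have opt: "0 \<le> (gx (x j) (y j) + q j *\<^sub>R x j + (1 / \<zeta>) *\<^sub>R (x (Suc j) - x j)) \<bullet> (x (Suc k) - x (Suc j))"
      by (rule x_optimality[OF assms mem(3)])
    then have opt: "0 \<le> (gx (x j) (y j) + q j *\<^sub>R x j + Z *\<^sub>R b) \<bullet> a"
      by (simp add: Z_def a_def b_def k_def)
    have xja: "x j \<bullet> a = x k \<bullet> a - b \<bullet> a" by (simp add: b_def inner_simps)
    show gja: "- q j * (x k \<bullet> a - b \<bullet> a) - Z * (b \<bullet> a) \<le> gx (x j) (y j) \<bullet> a"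
      using opt by (simp add: inner_add_left flip: xja)
    have "0 \<le> (gx (x k) (y k) + q k *\<^sub>R x k + Z *\<^sub>R a) \<bullet> (- a)"
      using x_optimality[OF k mem(2)] by (simp add: Z_def a_def)
    then show "e \<bullet> a + h \<bullet> a + q k * (x k \<bullet> a) - q j * (x k \<bullet> a - b \<bullet> a)
        + Z * ((norm a)\<^sup>2 - b \<bullet> a) \<le> 0"
      using gja by (simp add: e_def h_def inner_simps power2_norm_eq_inner algebra_simps)
    have "1 * \<bar>e \<bullet> a\<bar> \<le> \<zeta> * L21\<^sup>2 / 2 * D + Z / 2 * (norm a)\<^sup>2"
      using Z \<zeta>(1) by (intro young) (auto simp: power2_eq_square Z_def)
    then show "- E1 - Z / 2 * (norm a)\<^sup>2 \<le> e \<bullet> a" by (simp add: E1_def)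
    have "M * \<bar>e \<bullet> a\<bar> \<le> 16 * L21\<^sup>2 / (\<zeta> * (q k)\<^sup>2) * D + 4 * Z * (norm a)\<^sup>2"
      using Z \<zeta>(1) qk
      by (intro young) (auto simp: power2_eq_square Z_def M_def i_def field_simps)
    then have "\<bar>M * (e \<bullet> a)\<bar> \<le> E2 + 4 * Z * (norm a)\<^sup>2"
      using Z qk by (simp add: abs_mult M_def i_def E2_def)
    then show "- E2 - 4 * Z * (norm a)\<^sup>2 \<le> M * (e \<bullet> a)" by linarith
    show "- Z / 40 * (norm (a - b))\<^sup>2 \<le> h \<bullet> a"
      using gradient_change_bound[OF mem(1-4)] by (simp add: a_def b_def h_def Z_def field_simps)
    show "2 * (b \<bullet> a) = (norm a)\<^sup>2 + (norm b)\<^sup>2 - (norm (a - b))\<^sup>2"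
      by (simp add: power2_norm_eq_inner inner_simps inner_commute)
    show "2 * (x k \<bullet> a) = N1 - (norm (x k))\<^sup>2 - (norm a)\<^sup>2"
      by (simp add: N1_def a_def power2_norm_eq_inner inner_simps inner_commute)
    show "q k * i = 1" using qk by (simp add: i_def)
    show "q k \<le> q j" using q_antimono[OF assms] by (simp add: k_def)
    \<comment> \<open>The constant \<open>19/20\<close> in \<open>q\<close> makes this coefficient
      factor; it vanishes for \<open>j = 1\<close>.\<close>
    show "0 \<le> 19/40 * (M * Z) + 19/40 * Z - q j / 2 - 8 * Z * (q j * i)"
    proof -
      have MZ: "M * Z = Z * (320/19 * fourth_root k)"
        using Z by (simp add: M_def i_def inverse_q algebra_simps)
      have qj: "q j = Z * (19/20 / fourth_root j)"
        by (simp add: q_eq Z_def)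
      have qi: "q j * i = fourth_root k / fourth_root j"
        using q_ratio[of j] by (simp add: i_def k_def divide_inverse)
      have "19/40 * (M * Z) + 19/40 * Z - q j / 2 - 8 * Z * (q j * i) =
          Z * ((8 * fourth_root k + 19/40) * (1 - 1 / fourth_root j))"
        unfolding qi unfolding MZ qj using \<kappa> by (simp add: field_simps)
      also have "\<dots> \<ge> 0"
        using Z \<kappa> by (intro mult_nonneg_nonneg) auto
      finally show ?thesis .
    qed
    have "Z\<^sup>2 * ip = Z * (20/19 * fourth_root (Suc k))"
      using Z by (simp add: ip_def inverse_q power2_eq_square algebra_simps)
    also have "\<dots> \<le> Z * (20/19 * (fourth_root k + 1))"
      using Z fourth_root_Suc_le[of k] by (intro mult_left_mono) auto
    also have "\<dots> = Z\<^sup>2 * i + 20/19 * Z"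
      using Z by (simp add: i_def inverse_q power2_eq_square algebra_simps)
    finally show "Z\<^sup>2 * ip \<le> Z\<^sup>2 * i + 20/19 * Z" .
  qed (use Z qk in \<open>auto simp: i_def M_def\<close>)
  moreover have "E1 + E2 = (\<zeta> * L21\<^sup>2 / 2 + 16 * L21\<^sup>2 / (\<zeta> * (q k)\<^sup>2)) * D"
    by (simp add: E1_def E2_def distrib_right)
  moreover have "8 * Z * (q j * i - q k * ip) * N1 \<le> 8 * Z * (q j * i - q k * ip) * \<sigma>\<^sup>2"
  proof (rule mult_left_mono)
    show "N1 \<le> \<sigma>\<^sup>2" using norm_square_le_sigma mem by (simp add: N1_def)
    show "0 \<le> 8 * Z * (q j * i - q k * ip)"
      using q_ratio_antimono[OF assms] Z by (simp add: i_def ip_def k_def divide_inverse)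
  qed
  moreover have "(q j - q k) / 2 * N1 \<le> (q j - q k) / 2 * \<sigma>\<^sup>2"
    using norm_square_le_sigma mem q_antimono[OF assms] by (intro mult_left_mono) (auto simp: N1_def k_def)
  moreover have "potential k = f (x (Suc k)) (y (Suc k)) - 8 * Z\<^sup>2 * ip * (norm a)\<^sup>2
      + 8 * Z * (q k * ip - 1) * N1 + 15/2 * Z * (norm a)\<^sup>2 + q k / 2 * N1
      - (\<zeta> * L21\<^sup>2 / 2 + 16 * L21\<^sup>2 / (\<zeta> * (q (Suc k))\<^sup>2)) * (norm (y (Suc k) - y k))\<^sup>2"
    unfolding potential_def coeffs divide_inverse[of "q k" "q (Suc k)"] a_def N1_def ip_def
    by (simp add: right_diff_distrib left_diff_distrib)
  moreover have "potential j = f (x k) (y k) - 8 * Z\<^sup>2 * i * (norm b)\<^sup>2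
      + 8 * Z * (q j * i - 1) * (norm (x k))\<^sup>2 + 15/2 * Z * (norm b)\<^sup>2 + q j / 2 * (norm (x k))\<^sup>2
      - (\<zeta> * L21\<^sup>2 / 2 + 16 * L21\<^sup>2 / (\<zeta> * (q k)\<^sup>2)) * D"
    unfolding potential_def coeffs k_def[symmetric] divide_inverse[of "q j" "q k"] b_def D_def i_def
    by (simp add: right_diff_distrib left_diff_distrib)
  moreover note y_ascent[OF k, unfolded distrib_right[of _ "p k"]]
  moreover have "progress k = 9/10 * Z * (norm a)\<^sup>2 + p k * (norm (y (Suc k) - y k))\<^sup>2"
    by (simp add: progress_def a_def coeffs)
  moreover have "8 / \<zeta> * (q j / q k - q k / q (Suc k)) * \<sigma>\<^sup>2 = 8 * Z * (q j * i - q k * ip) * \<sigma>\<^sup>2"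
    unfolding coeffs i_def ip_def divide_inverse[of "q j"] divide_inverse[of "q k"] by (rule refl)
  moreover have "15/2 * Z * ((norm a)\<^sup>2 - (norm b)\<^sup>2) = 15/2 * Z * (norm a)\<^sup>2 - 15/2 * Z * (norm b)\<^sup>2"
    by (rule right_diff_distrib)
  ultimately show ?thesis
    unfolding k_def[symmetric] by linarith
qed

text \<open>Telescoping. The sum starts at 2 because each ascent also involves the step before it,
  whose index is at least 1.\<close>

lemma sum_progress_le_potential:
  assumes "M \<ge> 1"
  shows "(\<Sum>k=2..M. progress k) \<le> potential M - potential 1
    + 8 / \<zeta> * (q 1 / q 2 - q M / q (Suc M)) * \<sigma>\<^sup>2 + (q 1 - q M) / 2 * \<sigma>\<^sup>2"
  using assms
proof (induction M rule: dec_induct)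
  case base
  then show ?case by (simp add: numeral_2_eq_2)
next
  case (step M)
  then have "{2..Suc M} = insert (Suc M) {2..M}" by auto
  then have "(\<Sum>k=2..Suc M. progress k) = (\<Sum>k=2..M. progress k) + progress (Suc M)" by simp
  with step.IH potential_ascent[OF step.hyps(1)] show ?case
    by (simp add: algebra_simps diff_divide_distrib del: One_nat_def)
qed

text \<open>\<open>F0_const\<close> is generous: the squared steps together contribute nothing
  positive, which saves 15, and the 1 subtracted from the ratio of the \<open>q\<close> saves 8. The
  surplus 23 is kept for \<open>d3_ge\<close>.\<close>

lemma potential_le:
  assumes "k \<ge> 1"
  shows "potential k \<le> F0_const f X Y \<zeta> - 23 / \<zeta> * \<sigma>\<^sup>2"
proof -
  have mem: "x (Suc k) \<in> X" "y (Suc k) \<in> Y" using x_mem y_mem by auto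
  define A where "A = (norm (x (Suc k) - x k))\<^sup>2"
  have "8 / (\<zeta>\<^sup>2 * q (Suc k)) = 8 / \<zeta>\<^sup>2 * inverse (q (Suc k))"
    by (simp add: divide_inverse)
  also have "\<dots> = 160 / (19 * \<zeta>) * fourth_root (Suc k)"
    using \<zeta>(1) by (simp add: inverse_q power2_eq_square)
  also have "\<dots> \<ge> 160 / (19 * \<zeta>) * 1"
    using \<zeta>(1) by (intro mult_left_mono fourth_root_ge_1) auto
  also have "160 / (19 * \<zeta>) * 1 \<ge> 15 / (2 * \<zeta>)"
    using \<zeta>(1) by (simp add: divide_simps)
  finally have "15 / (2 * \<zeta>) * A \<le> 8 / (\<zeta>\<^sup>2 * q (Suc k)) * A"
    by (rule mult_right_mono) (simp add: A_def)
  moreover have "- 8 / \<zeta> * (1 - q k / q (Suc k)) * (norm (x (Suc k)))\<^sup>2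
      \<le> 8 / \<zeta> * (2 powr (1/4) - 1) * \<sigma>\<^sup>2"
  proof -
    have "8 / \<zeta> * (q k / q (Suc k) - 1) * (norm (x (Suc k)))\<^sup>2
        \<le> 8 / \<zeta> * (2 powr (1/4) - 1) * \<sigma>\<^sup>2"
      using \<zeta>(1) q_ratio_le[OF assms] norm_square_le_sigma[OF mem(1)]
      by (intro mult_mono mult_left_mono mult_nonneg_nonneg) (auto simp: ge_one_powr_ge_zero)
    moreover have "- 8 / \<zeta> * (1 - q k / q (Suc k)) = 8 / \<zeta> * (q k / q (Suc k) - 1)"
      by (simp add: algebra_simps)
    ultimately show ?thesis by simp
  qed
  moreover have "q k / 2 * (norm (x (Suc k)))\<^sup>2 \<le> 19 / (40 * \<zeta>) * \<sigma>\<^sup>2"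
    using \<zeta>(1) q_le_q_1[OF assms] q_pos[OF assms] norm_square_le_sigma[OF mem(1)]
    by (intro mult_mono) auto
  moreover have "0 \<le> (\<zeta> * L21\<^sup>2 / 2 + 16 * L21\<^sup>2 / (\<zeta> * (q (Suc k))\<^sup>2)) * (norm (y (Suc k) - y k))\<^sup>2"
    using \<zeta>(1) by simp
  moreover have "potential k = f (x (Suc k)) (y (Suc k)) - 8 / (\<zeta>\<^sup>2 * q (Suc k)) * A
    + - 8 / \<zeta> * (1 - q k / q (Suc k)) * (norm (x (Suc k)))\<^sup>2 + 15 / (2 * \<zeta>) * A
    + q k / 2 * (norm (x (Suc k)))\<^sup>2
    - (\<zeta> * L21\<^sup>2 / 2 + 16 * L21\<^sup>2 / (\<zeta> * (q (Suc k))\<^sup>2)) * (norm (y (Suc k) - y k))\<^sup>2"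
    by (simp add: potential_def A_def)
  ultimately have "potential k \<le> f_max f X Y + 8 / \<zeta> * (2 powr (1/4) - 1) * \<sigma>\<^sup>2 + 19 / (40 * \<zeta>) * \<sigma>\<^sup>2"
    using f_le_f_max[OF mem] by linarith
  also have "(2::real) powr (13/4) = 8 * 2 powr (1/4)"
    using powr_add[of "2::real" 3 "1/4"] by simp
  then have "f_max f X Y + 8 / \<zeta> * (2 powr (1/4) - 1) * \<sigma>\<^sup>2 + 19 / (40 * \<zeta>) * \<sigma>\<^sup>2
      = F0_const f X Y \<zeta> - 23 / \<zeta> * \<sigma>\<^sup>2"
    using \<zeta>(1) by (simp add: F0_const_def field_simps)
  finally show ?thesis .
qed

abbreviation "d3 \<equiv> d3_const f X Y \<zeta> L21 x y"
abbreviation "d4 \<equiv> d4_const \<zeta> \<nu> \<tau> L12 L21"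

text \<open>Lets the constant of the counting argument outweigh the indices at which the
  regularization is still large.\<close>

lemma d3_ge: "23 / \<zeta> * \<sigma>\<^sup>2 \<le> d3"
proof -
  have "0 \<le> 8 * 2 powr (1/4) / \<zeta> * \<sigma>\<^sup>2" "0 \<le> 19 / (40 * \<zeta>) * \<sigma>\<^sup>2"
    using \<zeta>(1) by auto
  then show ?thesis
    using potential_le[of 1] unfolding potential_1 d3_const_def by linarith
qed

lemma sum_progress_le_d3: "(\<Sum>k=2..M. progress k) \<le> d3"
proof (cases "M \<ge> 1")
  case True
  have "8 / \<zeta> * (q 1 / q 2 - q M / q (Suc M)) * \<sigma>\<^sup>2 \<le> 8 * 2 powr (1/4) / \<zeta> * \<sigma>\<^sup>2"
  proof (rule mult_right_mono)
    have "q 1 / q 2 - q M / q (Suc M) \<le> 2 powr (1/4)"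
      using q_ratio_le[of 1] divide_pos_pos[OF q_pos[OF True] q_pos[of "Suc M"]]
      by (simp add: numeral_2_eq_2)
    then have "8 / \<zeta> * (q 1 / q 2 - q M / q (Suc M)) \<le> 8 / \<zeta> * 2 powr (1/4)"
      using \<zeta>(1) by (intro mult_left_mono) auto
    then show "8 / \<zeta> * (q 1 / q 2 - q M / q (Suc M)) \<le> 8 * 2 powr (1/4) / \<zeta>" by simp
  qed simp
  moreover have "(q 1 - q M) / 2 * \<sigma>\<^sup>2 \<le> 19 / (40 * \<zeta>) * \<sigma>\<^sup>2"
    using q_1 q_pos[OF True] by (intro mult_right_mono) auto
  moreover have "0 \<le> 23 / \<zeta> * \<sigma>\<^sup>2" using \<zeta>(1) by simp
  ultimately show ?thesis
    using sum_progress_le_potential[OF True] potential_le[OF True]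
    unfolding potential_1 d3_const_def by linarith
next
  case False
  have "0 \<le> 23 / \<zeta> * \<sigma>\<^sup>2" using \<zeta>(1) by simp
  also note d3_ge
  finally show ?thesis using False by simp
qed

section \<open>From the potential to the stationarity gap\<close>

abbreviation "gap \<equiv> stationarity_gap X Y gx gy \<zeta> \<gamma> x y"

text \<open>An upper bound for the squared gap of the regularized problem, not that gap itself: its
  \<open>y\<close> block is estimated through both steps, whence the factors 2.\<close>

definition regularized_gap_square :: "nat \<Rightarrow> real" where
  "regularized_gap_square k = (1 / \<zeta>\<^sup>2 + 2 * L12\<^sup>2) * (norm (x (Suc k) - x k))\<^sup>2
    + 2 * (\<gamma> k)\<^sup>2 * (norm (y (Suc k) - y k))\<^sup>2"

text \<open>Projections are nonexpansive. Dropping the regularization moves the \<open>x\<close>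
  block by at most \<open>q k * \<sigma>\<close>, and evaluating \<open>gy\<close> at
  \<open>x k\<close> instead of \<open>x (Suc k)\<close> moves the \<open>y\<close> block by at most
  \<open>L12 * norm a\<close>.\<close>

lemma norm_gap_le:
  assumes "k \<ge> 1"
  shows "norm (gap k) \<le> sqrt (regularized_gap_square k) + q k * \<sigma>"
proof -
  have mem: "x k \<in> X" "x (Suc k) \<in> X" "y k \<in> Y" using x_mem y_mem assms by auto
  define a where "a = x (Suc k) - x k"
  define c where "c = y (Suc k) - y k"
  define Px where "Px = closest_point X (x k - \<zeta> *\<^sub>R gx (x k) (y k))"
  define Py where "Py = closest_point Y (y k + (1 / \<gamma> k) *\<^sub>R gy (x k) (y k))"
  have \<gamma>: "\<gamma> k > 0" by (rule gamma_pos[OF assms])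
  have "norm (x (Suc k) - Px) \<le> \<zeta> * q k * norm (x k)"
    using closest_point_lipschitz[OF X(4,2,1), of "x k - \<zeta> *\<^sub>R gx (x k) (y k) - (\<zeta> * q k) *\<^sub>R x k"
        "x k - \<zeta> *\<^sub>R gx (x k) (y k)"] \<zeta>(1) q_pos[OF assms]
    by (simp add: x_Suc[OF assms] Px_def dist_norm)
  also have "\<dots> \<le> \<zeta> * q k * \<sigma>"
    using \<zeta>(1) q_pos[OF assms] norm_le_sigma[OF mem(1)] by (intro mult_left_mono) auto
  finally have ex: "norm ((1 / \<zeta>) *\<^sub>R (x (Suc k) - Px)) \<le> q k * \<sigma>"
    using \<zeta>(1) by (simp add: pos_divide_le_eq mult_ac)
  have "norm (y (Suc k) - Py) \<le> norm ((1 / \<gamma> k) *\<^sub>R (gy (x (Suc k)) (y k) - gy (x k) (y k)))"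
    using closest_point_lipschitz[OF Y(4,2,1), of "y k + (1 / \<gamma> k) *\<^sub>R gy (x (Suc k)) (y k)"
        "y k + (1 / \<gamma> k) *\<^sub>R gy (x k) (y k)"]
    by (simp add: y_Suc[OF assms] Py_def dist_norm scaleR_diff_right)
  also have "\<dots> \<le> (1 / \<gamma> k) * (L12 * norm a)"
    using lip_yx[OF mem(2,1,3)] \<gamma> by (simp add: a_def divide_right_mono)
  finally have "\<gamma> k * norm (y (Suc k) - Py) \<le> L12 * norm a"
    using \<gamma> by (simp add: field_simps)
  moreover have "norm (\<gamma> k *\<^sub>R (y k - Py)) = norm (\<gamma> k *\<^sub>R (y (Suc k) - Py) - \<gamma> k *\<^sub>R c)"
    by (simp add: c_def flip: scaleR_diff_right)
  moreover have "\<dots> \<le> norm (\<gamma> k *\<^sub>R (y (Suc k) - Py)) + norm (\<gamma> k *\<^sub>R c)"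
    by (rule norm_triangle_ineq4)
  ultimately have "norm (\<gamma> k *\<^sub>R (y k - Py)) \<le> L12 * norm a + \<gamma> k * norm c"
    using \<gamma> by simp
  then have "(norm (\<gamma> k *\<^sub>R (y k - Py)))\<^sup>2 \<le> (L12 * norm a + \<gamma> k * norm c)\<^sup>2"
    by (intro power_mono) auto
  also have "\<dots> \<le> 2 * L12\<^sup>2 * (norm a)\<^sup>2 + 2 * (\<gamma> k)\<^sup>2 * (norm c)\<^sup>2"
    using sum_squares_bound[of "L12 * norm a" "\<gamma> k * norm c"]
    by (simp add: power2_sum power_mult_distrib mult_ac)
  finally have "(norm ((1 / \<zeta>) *\<^sub>R a))\<^sup>2 + (norm (\<gamma> k *\<^sub>R (y k - Py)))\<^sup>2 \<le> regularized_gap_square k"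
    by (simp add: regularized_gap_square_def a_def c_def distrib_right power_divide power_mult_distrib)
  then have reg: "norm ((1 / \<zeta>) *\<^sub>R (- a), \<gamma> k *\<^sub>R (y k - Py)) \<le> sqrt (regularized_gap_square k)"
    by (simp add: norm_Pair)
  have "gap k = ((1 / \<zeta>) *\<^sub>R (- a), \<gamma> k *\<^sub>R (y k - Py)) + ((1 / \<zeta>) *\<^sub>R (x (Suc k) - Px), 0)"
    by (simp add: stationarity_gap_def Px_def Py_def a_def flip: scaleR_add_right)
  then have "norm (gap k) \<le> norm ((1 / \<zeta>) *\<^sub>R (- a), \<gamma> k *\<^sub>R (y k - Py))
      + norm ((1 / \<zeta>) *\<^sub>R (x (Suc k) - Px), 0 :: 'b)"
    by (metis norm_triangle_ineq)
  also have "norm ((1 / \<zeta>) *\<^sub>R (x (Suc k) - Px), 0 :: 'b) = norm ((1 / \<zeta>) *\<^sub>R (x (Suc k) - Px))"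
    by (simp add: norm_Pair)
  finally show ?thesis using reg ex by linarith
qed

text \<open>\<open>\<gamma> k\<close> is a multiple \<open>w\<close> of \<open>p k\<close> plus a
  constant \<open>e\<close>. The constant is absorbed through \<open>p0\<close>, which is
  \<open>p k\<close> without its factor \<open>sqrt (real (Suc k)) \<ge> 1\<close>.\<close>

lemma gamma_square_le: "2 * (\<gamma> k)\<^sup>2 \<le> D1_const \<zeta> \<nu> \<tau> L21 * (p k)\<^sup>2"
proof -
  define e where "e = \<zeta> * L21\<^sup>2 - \<nu>"
  define w where "w = 2 * \<tau> / (\<tau> - 2) * p k"
  define p0 where "p0 = 3200 * \<zeta> * (\<tau> - 2) * L21\<^sup>2 / 361"
  note pos = \<zeta>(1) tau_gt_2 L_pos(3)
  define t where "t = \<tau> - 2"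
  have "t > 0" using pos by (simp add: t_def)
  then have "w = 16 * \<tau> * L21\<^sup>2 / (\<zeta> * (q (k + 1))\<^sup>2)"
    unfolding w_def p_par_def t_def[symmetric] by simp
  then have "\<gamma> k = w + e"
    by (simp add: e_def gamma_par_def gammabar_par_def)
  then have "2 * (\<gamma> k)\<^sup>2 \<le> 4 * w\<^sup>2 + 4 * e\<^sup>2"
    using sum_squares_bound[of w e] by (simp add: power2_sum)
  also have "4 * w\<^sup>2 = 16 * \<tau>\<^sup>2 / (\<tau> - 2)\<^sup>2 * (p k)\<^sup>2"
    by (simp add: w_def power_mult_distrib power_divide)
  also have "4 * e\<^sup>2 = 19 ^ 4 * e\<^sup>2 / (16 * 20 ^ 4 * (\<tau> - 2)\<^sup>2 * L21 ^ 4 * \<zeta>\<^sup>2) * p0\<^sup>2"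
    using pos by (simp add: p0_def power_mult_distrib power_divide flip: power_mult)
  also have "\<dots> \<le> 19 ^ 4 * e\<^sup>2 / (16 * 20 ^ 4 * (\<tau> - 2)\<^sup>2 * L21 ^ 4 * \<zeta>\<^sup>2) * (p k)\<^sup>2"
  proof (intro mult_left_mono power_mono)
    have "p0 * 1 \<le> p0 * sqrt (real (Suc k))"
      using pos by (intro mult_left_mono) (auto simp: p0_def)
    then show "p0 \<le> p k" by (simp add: p0_def p_eq)
  qed (use pos in \<open>auto simp: p0_def\<close>)
  finally show ?thesis by (simp add: D1_const_def e_def distrib_right)
qed

text \<open>The two entries of the maximum \<open>d4\<close> are the ratios needed for the
  \<open>y\<close> and the \<open>x\<close> term. The latter is normalized by \<open>p 2\<close>,
  hence \<open>k \<ge> 2\<close> and the monotonicity of \<open>p\<close>.\<close>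

lemma regularized_gap_square_le:
  assumes "k \<ge> 2"
  shows "regularized_gap_square k \<le> d4 * p k * progress k"
proof -
  have "p k > 0" "p 2 > 0" by (rule p_pos)+
  have "1 / \<zeta>\<^sup>2 + 2 * L12\<^sup>2 = (10 + 20 * \<zeta>\<^sup>2 * L12\<^sup>2) / (9 * \<zeta> * p 2) * p 2 * (9 / (10 * \<zeta>))"
    using \<zeta>(1) \<open>p 2 > 0\<close> by (simp add: field_simps power2_eq_square)
  also have "\<dots> \<le> d4 * p k * (9 / (10 * \<zeta>))"
    using \<zeta>(1) \<open>p k > 0\<close> \<open>p 2 > 0\<close> p_mono[OF assms]
    by (intro mult_right_mono mult_mono) (auto simp: d4_const_def le_max_iff_disj)
  finally have "(1 / \<zeta>\<^sup>2 + 2 * L12\<^sup>2) * (norm (x (Suc k) - x k))\<^sup>2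
      \<le> d4 * p k * (9 / (10 * \<zeta>)) * (norm (x (Suc k) - x k))\<^sup>2"
    by (rule mult_right_mono) simp
  moreover have "2 * (\<gamma> k)\<^sup>2 \<le> d4 * (p k)\<^sup>2"
    using gamma_square_le[of k] mult_right_mono[of "D1_const \<zeta> \<nu> \<tau> L21" d4 "(p k)\<^sup>2"]
    by (simp add: d4_const_def)
  then have "2 * (\<gamma> k)\<^sup>2 * (norm (y (Suc k) - y k))\<^sup>2 \<le> d4 * (p k)\<^sup>2 * (norm (y (Suc k) - y k))\<^sup>2"
    by (rule mult_right_mono) simp
  ultimately show ?thesis
    by (simp add: regularized_gap_square_def progress_def distrib_left power2_eq_square mult_ac)
qed

section \<open>The counting argument\<close>

lemma progress_nonneg: "progress k \<ge> 0"
  using \<zeta>(1) p_pos[of k] by (simp add: progress_def)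

lemma d4_nonneg: "d4 \<ge> 0"
proof -
  have "D1_const \<zeta> \<nu> \<tau> L21 \<ge> 0" by (simp add: D1_const_def)
  then show ?thesis by (simp add: d4_const_def le_max_iff_disj)
qed

text \<open>If all gaps were large, each index in \<open>{N..M}\<close> would use up at least
  \<open>1 / sqrt (real k + 1)\<close> of the budget \<open>C\<close>. The sum exceeds
  \<open>2 * (C - s\<^sup>2)\<close>, hence \<open>C < 2 * s\<^sup>2\<close>, contrary to
  \<open>sC\<close>.\<close>

lemma exists_small_gap:
  assumes \<epsilon>: "\<epsilon> > 0"
  defines "C \<equiv> 2 * 80\<^sup>2 * \<zeta> * (\<tau> - 2) * L21\<^sup>2 * d3 * d4 / (19\<^sup>2 * \<epsilon>\<^sup>2)"
  shows "\<exists>k\<ge>1. real k \<le> (C + 2)\<^sup>2 \<and> norm (gap k) \<le> \<epsilon>"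
proof (rule ccontr)
  assume "\<not> ?thesis"
  then have large: "norm (gap k) > \<epsilon>" if "k \<ge> 1" "real k \<le> (C + 2)\<^sup>2" for k
    using that by force
  note pos = \<zeta>(1) tau_gt_2 L_pos(3)
  \<comment> \<open>\<open>s \<le> fourth_root k\<close> is equivalent to
    \<open>q k * \<sigma> \<le> \<epsilon> / 2\<close>; thus \<open>s ^ 4\<close> is the second
    entry of the maximum in the theorem.\<close>
  define s where "s = 19 * \<sigma> / (10 * \<zeta> * \<epsilon>)"
  have "0 \<le> norm (x 1)" by simp
  also have "\<dots> \<le> \<sigma>" by (rule norm_le_sigma[OF x_1])
  finally have \<sigma>: "\<sigma> \<ge> 0" .
  then have s0: "s \<ge> 0" using pos \<epsilon> by (simp add: s_def)
  text \<open>
    The iterations at which the regularization \<open>q k\<close> is still large have to be discarded from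
    the counting argument. There are few of them compared to \<open>C\<^sup>2\<close>, since \<open>d3\<close> contains a
    multiple of \<open>\<sigma>\<^sup>2 / \<zeta>\<close>.
  \<close>
  have sC: "2 * s\<^sup>2 \<le> C"
  proof -
    \<comment> \<open>\<open>p 2\<close> contains \<open>sqrt 3\<close>, estimated by 2; the margin
      between \<open>460 / 9\<close> and \<open>361 / 50\<close> below is ample.\<close>
    have "p 2 \<le> 3200 * \<zeta> * (\<tau> - 2) * L21\<^sup>2 * 2 / 361"
      unfolding p_eq using pos by (intro divide_right_mono mult_left_mono real_le_lsqrt) auto
    then have p2: "361 / 6400 * p 2 \<le> \<zeta> * (\<tau> - 2) * L21\<^sup>2" by simp
    have d4: "10 / (9 * \<zeta> * p 2) \<le> d4"
    proof -
      have "10 / (9 * \<zeta> * p 2) \<le> (10 + 20 * \<zeta>\<^sup>2 * L12\<^sup>2) / (9 * \<zeta> * p 2)"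
        using pos p_pos[of 2] by (intro divide_right_mono) auto
      then show ?thesis by (simp add: d4_const_def le_max_iff_disj)
    qed
    have "361 / 6400 * p 2 * (10 / (9 * \<zeta> * p 2)) \<le> \<zeta> * (\<tau> - 2) * L21\<^sup>2 * d4"
      by (rule mult_mono[OF p2 d4]) (use pos p_pos[of 2] in auto)
    moreover have "361 / 6400 * p 2 * (10 / (9 * \<zeta> * p 2)) = 361 / (5760 * \<zeta>)"
      using pos p_pos[of 2] by simp
    ultimately have "361 / (5760 * \<zeta>) * (23 / \<zeta> * \<sigma>\<^sup>2) \<le> \<zeta> * (\<tau> - 2) * L21\<^sup>2 * d4 * d3"
      using pos d3_ge d4_nonneg by (intro mult_mono) auto
    then have "2 * 80\<^sup>2 * (361 / (5760 * \<zeta>) * (23 / \<zeta> * \<sigma>\<^sup>2)) / (19\<^sup>2 * \<epsilon>\<^sup>2)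
        \<le> 2 * 80\<^sup>2 * (\<zeta> * (\<tau> - 2) * L21\<^sup>2 * d4 * d3) / (19\<^sup>2 * \<epsilon>\<^sup>2)"
      by (intro divide_right_mono mult_left_mono) auto
    also have "\<dots> = C" by (simp add: C_def mult_ac)
    finally have "2 * 80\<^sup>2 * (361 / (5760 * \<zeta>) * (23 / \<zeta> * \<sigma>\<^sup>2)) / (19\<^sup>2 * \<epsilon>\<^sup>2) \<le> C" .
    moreover have "2 * 80\<^sup>2 * (361 / (5760 * \<zeta>) * (23 / \<zeta> * \<sigma>\<^sup>2)) / (19\<^sup>2 * \<epsilon>\<^sup>2)
        = 460 / 9 * (\<sigma>\<^sup>2 / (\<zeta>\<^sup>2 * \<epsilon>\<^sup>2))"
      using pos \<epsilon> by (simp add: field_simps power2_eq_square)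
    moreover have "2 * s\<^sup>2 = 361 / 50 * (\<sigma>\<^sup>2 / (\<zeta>\<^sup>2 * \<epsilon>\<^sup>2))"
      by (simp add: s_def power_divide power_mult_distrib)
    moreover have "361 / 50 * (\<sigma>\<^sup>2 / (\<zeta>\<^sup>2 * \<epsilon>\<^sup>2)) \<le> 460 / 9 * (\<sigma>\<^sup>2 / (\<zeta>\<^sup>2 * \<epsilon>\<^sup>2))"
      by (intro mult_right_mono) auto
    ultimately show ?thesis by linarith
  qed
  \<comment> \<open>From \<open>N\<close> on, both \<open>regularized_gap_square_le\<close> and the
    bound on \<open>q k * \<sigma>\<close> apply; \<open>M\<close> is the last index at which a
    large gap is assumed.\<close>
  define N where "N = nat \<lceil>max 2 (s ^ 4)\<rceil>"
  define M where "M = nat \<lfloor>(C + 2)\<^sup>2\<rfloor>"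
  have N: "max 2 (s ^ 4) \<le> real N" "real N \<le> max 2 (s ^ 4) + 1"
    unfolding N_def by linarith+
  have M: "real M \<le> (C + 2)\<^sup>2" "(C + 2)\<^sup>2 < real M + 1"
    unfolding M_def by (simp_all add: of_nat_nat)
  have "1 / sqrt (real k + 1) \<le> 2 * 80\<^sup>2 * \<zeta> * (\<tau> - 2) * L21\<^sup>2 * d4 / (19\<^sup>2 * \<epsilon>\<^sup>2) * progress k"
    if "k \<in> {N..M}" for k
  proof -
    have k: "2 \<le> real k" "s ^ 4 \<le> real k" "k \<ge> 2" "k \<ge> 1" "real k \<le> (C + 2)\<^sup>2"
      using that N M by auto
    have "s ^ 4 \<le> fourth_root k ^ 4" using k by (simp add: fourth_root_power4)
    then have "s \<le> fourth_root k" using power_mono_iff[of s "fourth_root k" 4] s0 by simp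
    then have "q k * \<sigma> \<le> \<epsilon> / 2"
      using pos \<epsilon> fourth_root_ge_1[OF k(4)] by (simp add: s_def q_eq field_simps)
    then have "\<epsilon> / 2 < sqrt (regularized_gap_square k)"
      using norm_gap_le[OF k(4)] large[OF k(4,5)] by linarith
    then have "\<epsilon> / 2 \<le> sqrt (d4 * p k * progress k)"
      using real_sqrt_le_mono[OF regularized_gap_square_le[OF k(3)]] by linarith
    then have "(\<epsilon> / 2)\<^sup>2 \<le> (sqrt (d4 * p k * progress k))\<^sup>2"
      using \<epsilon> by (intro power_mono) auto
    also have "\<dots> = d4 * p k * progress k"
      using d4_nonneg p_pos[of k] progress_nonneg[of k] by simp
    finally have "\<epsilon>\<^sup>2 \<le> 4 * d4 * p k * progress k"
      by (simp add: power_divide)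
    then show ?thesis
      using pos \<epsilon> by (simp add: p_eq field_simps)
  qed
  then have "(\<Sum>k=N..M. 1 / sqrt (real k + 1))
      \<le> (\<Sum>k=N..M. 2 * 80\<^sup>2 * \<zeta> * (\<tau> - 2) * L21\<^sup>2 * d4 / (19\<^sup>2 * \<epsilon>\<^sup>2) * progress k)"
    by (rule sum_mono)
  also have "\<dots> = 2 * 80\<^sup>2 * \<zeta> * (\<tau> - 2) * L21\<^sup>2 * d4 / (19\<^sup>2 * \<epsilon>\<^sup>2) * (\<Sum>k=N..M. progress k)"
    by (rule sum_distrib_left[symmetric])
  also have "\<dots> \<le> 2 * 80\<^sup>2 * \<zeta> * (\<tau> - 2) * L21\<^sup>2 * d4 / (19\<^sup>2 * \<epsilon>\<^sup>2) * d3"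
  proof (rule mult_left_mono)
    have "(\<Sum>k=N..M. progress k) \<le> (\<Sum>k=2..M. progress k)"
      using N by (intro sum_mono2) (auto simp: progress_nonneg)
    also note sum_progress_le_d3
    finally show "(\<Sum>k=N..M. progress k) \<le> d3" .
  qed (use pos d4_nonneg in auto)
  also have "\<dots> = C" by (simp add: C_def)
  finally have "2 * (sqrt (real M + 2) - sqrt (real N + 1)) \<le> C"
    using sum_inverse_sqrt_lower_bound[of M N] by linarith
  moreover have "sqrt (real N + 1) \<le> s\<^sup>2 + 2"
  proof (rule real_le_lsqrt)
    have "(s\<^sup>2 + 2)\<^sup>2 = s ^ 4 + 4 * s\<^sup>2 + 4" by algebra
    then have "max 2 (s ^ 4) + 2 \<le> (s\<^sup>2 + 2)\<^sup>2" by simp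
    then show "real N + 1 \<le> (s\<^sup>2 + 2)\<^sup>2" using N by linarith
  qed simp
  moreover have "C + 2 < sqrt (real M + 2)"
    using M by (intro real_less_rsqrt) linarith
  ultimately have "2 * ((C + 2) - (s\<^sup>2 + 2)) < C"
    by argo
  then show False using sC by argo
qed

end

theorem theorem4p2:
  fixes X :: "'a::euclidean_space set" and Y :: "'b::euclidean_space set"
    and f :: "'a \<Rightarrow> 'b \<Rightarrow> real"
    and gx :: "'a \<Rightarrow> 'b \<Rightarrow> 'a" and gy :: "'a \<Rightarrow> 'b \<Rightarrow> 'b"
    and L11 L12 L21 L22 \<zeta> \<nu> \<tau> \<epsilon> :: real
    and x :: "nat \<Rightarrow> 'a" and y :: "nat \<Rightarrow> 'b"
  assumes X: "X \<noteq> {}" "closed X" "bounded X" "convex X"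
    and Y: "Y \<noteq> {}" "closed Y" "bounded Y" "convex Y"
    and grad: "has_gradient_blocks f gx gy X Y"
    and cvx: "\<And>v. v \<in> Y \<Longrightarrow> convex_on X (\<lambda>u. f u v)"
    and L_pos: "L11 > 0" "L12 > 0" "L21 > 0" "L22 > 0"
    and lip: "lipschitz_gradient gx gy X Y L11 L12 L21 L22"
    and \<zeta>: "\<zeta> > 0" "\<zeta> \<le> 1 / (10 * L11)"
    and \<nu>: "\<nu> > 0"
    and \<tau>: "\<tau> > max (19\<^sup>2 * (L22 + 2 * \<nu> - \<zeta> * L21\<^sup>2) / (20\<^sup>2 * 16 * \<zeta> * L21\<^sup>2)) 2"
    and iter: "agp_iterates X Y gx gy \<zeta> (q_par \<zeta>) (gamma_par \<zeta> \<nu> \<tau> L21) x y"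
    and \<epsilon>: "\<epsilon> > 0"
  shows "ereal_of_enat (first_hit (stationarity_gap X Y gx gy \<zeta> (gamma_par \<zeta> \<nu> \<tau> L21) x y) \<epsilon>)
    \<le> ereal (max
        ((2 * 80\<^sup>2 * \<zeta> * (\<tau> - 2) * L21\<^sup>2 * d3_const f X Y \<zeta> L21 x y * d4_const \<zeta> \<nu> \<tau> L12 L21
            / (19\<^sup>2 * \<epsilon>\<^sup>2) + 2)\<^sup>2)
        (19 ^ 4 * sigma_x X ^ 4 / (10 ^ 4 * \<zeta> ^ 4 * \<epsilon> ^ 4)))"
proof -
  interpret convex_nonconcave_agp X Y f gx gy L11 L12 L21 L22 \<zeta> \<nu> \<tau> x y
    by unfold_locales fact+
  obtain k where k: "k \<ge> 1" "norm (gap k) \<le> \<epsilon>"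
    "real k \<le> (2 * 80\<^sup>2 * \<zeta> * (\<tau> - 2) * L21\<^sup>2 * d3 * d4 / (19\<^sup>2 * \<epsilon>\<^sup>2) + 2)\<^sup>2"
    using exists_small_gap[OF \<epsilon>] by blast
  have "ereal_of_enat (first_hit gap \<epsilon>) \<le> ereal_of_enat (enat k)"
    using k unfolding first_hit_def ereal_of_enat_le_iff by (intro INF_lower) auto
  also have "\<dots> = ereal (real k)" by simp
  also have "\<dots> \<le> ereal (max
      ((2 * 80\<^sup>2 * \<zeta> * (\<tau> - 2) * L21\<^sup>2 * d3 * d4 / (19\<^sup>2 * \<epsilon>\<^sup>2) + 2)\<^sup>2)
      (19 ^ 4 * \<sigma> ^ 4 / (10 ^ 4 * \<zeta> ^ 4 * \<epsilon> ^ 4)))"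
    using k(3) by (simp only: ereal_less_eq le_max_iff_disj simp_thms)
  finally show ?thesis .
qed

end
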